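(* Let $I=(i_1,\dots,i_{l(I)})$ be a partition of $n$ (i.e. a composition with $i_1\ge i_2\ge\dots\ge i_{l(I)}$), and for compositions $J$ put $$\mathbf{f}(J):=\frac{1}{|J|}\frac{(-1)^{l(J)-1}}{\binom{|J|-1}{l(J)-1}}.$$ Then the function on compositions $J$ of $n$ given by $$\mathbf{f}_I(J):=\frac{1}{l(I)!}\sum_{I':\lambda(I')=\lambda(I)}\ \prod_{r=1}^{l(I')}\mathbf{f}(J_r)=\frac{1}{l(I)!\,i_1\cdots i_{l(I)}}\sum_{I':\lambda(I')=\lambda(I)}\ \prod_{r=1}^{l(I')}\frac{(-1)^{l(J_r)-1}}{\binom{|J_r|-1}{l(J_r)-1}},$$ where $(J_1,\dots,J_{l(I')})$ is the decomposition of $J$ relative to $I'$, is a right eigenfunction of eigenvalue $a^{l(I)-n}$ of the $a$th Hopf-power Markov chain on compositions of $n$. The numbers $\mathbf{f}_I(J)$ appear as coefficients in the Garsia–Reutenauer idempotent $E_I$: $$E_I=\sum_{\sigma\in\mathfrak{S}_n}\mathbf{f}_I(\mathrm{Des}(\sigma))\,\sigma.$$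
   Context: A composition of $n$ is a list $I=(i_1,\dots,i_{l(I)})$ of positive integers with sum $|I|=n$; $\lambda(I)$ is the multiset of its parts; $J\ge I$ means $J$ refines $I$. Sums over $I'$ run over (distinct) compositions $I'$. For compositions $I,J$ of $n$, the decomposition of $J$ relative to $I$ is the tuple $(J_1,\dots,J_{l(I)})$ of compositions with $|J_r|=i_r$ and each $l(J_r)$ minimal such that the concatenation $J_1\cdots J_{l(I)}$ refines $J$ (draw $J$ as $n$ dots with divisions between parts and split at the divisions of $I$). E.g. the decomposition of $(3,5,2,1)$ relative to $(4,4,3)$ is $((3,1),(4),(2,1))$. For a word (or permutation in one-line notation) $w=w_1\cdots w_n$, $\mathrm{Des}(w)=(i_1,\dots,i_l)$ is the composition of $n$ such that $w_r>w_{r+1}$ exactly when $r=i_1+\dots+i_j$ for some $1\le j<l$. $QSym$ is the subalgebra of the power series over $\mathbb{R}$ in commuting variables $x_1,x_2,\dots$ spanned by $M_I=\sum_{j_1<\dots<j_{l(I)}}x_{j_1}^{i_1}\cdots x_{j_{l(I)}}^{i_{l(I)}}$, with coproduct $\Delta(M_I)=\sum_{j=0}^{l(I)}M_{(i_1,\dots,i_j)}\otimes M_{(i_{j+1},\dots,i_{l(I)})}$, and $F_I=\sum_{J\ge I}M_J$. With $\Psi^a=m^{[a]}\Delta^{[a]}$ ($a$-fold coproduct followed by $a$-fold product), the $a$th Hopf-power Markov chain on compositions of $n$ has transition matrix $K$ given by $a^{-n}\Psi^a(F_I)=\sum_{|J|=n}K(I,J)F_J$. A right eigenfunction of eigenvalue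 $\beta$ is a function $\mathbf f$ with $\sum_{J'}K(J,J')\mathbf f(J')=\beta\,\mathbf f(J)$ for all $J$. Garsia–Reutenauer idempotents: in the rational group algebra of $\mathfrak{S}_n$, for a composition $q$ of $n$ let $B_q:=\sum_{\sigma:\ q\ge\mathrm{Des}(\sigma)}\sigma$. For a composition $p$ of $n$ let $I_p:=\sum_{q\ge p}\left(\prod_{r=1}^{l(p)}\frac{(-1)^{l(q_r)-1}}{l(q_r)}\right)B_q$, where $(q_1,\dots,q_{l(p)})$ is the decomposition of $q$ relative to $p$. For a partition $I$ of $n$, $E_I:=\frac{1}{l(I)!}\sum_{p:\lambda(p)=\lambda(I)}I_p$. *)

theory Defs
  imports
    Complex_Main
    "HOL-Library.Poly_Mapping"
    "HOL-Library.Multiset"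
    "HOL-Combinatorics.Permutations"
begin

section \<open>Compositions\<close>

definition compositions :: "nat \<Rightarrow> nat list set" where
  "compositions n = {I. (\<forall>i\<in>set I. 0 < i) \<and> sum_list I = n}"

definition all_compositions :: "nat list set" where
  "all_compositions = {I. \<forall>i\<in>set I. 0 < i}"

text \<open>\<open>refines J I\<close> is the relation written \<open>J \<ge> I\<close> on paper: \<open>J\<close> is obtained by
  splitting every part of \<open>I\<close>.\<close>

definition refines :: "nat list \<Rightarrow> nat list \<Rightarrow> bool" where
  "refines J I \<longleftrightarrow> J \<in> all_compositions \<and> I \<in> all_compositions \<and>
     (\<exists>Ks. concat Ks = J \<and> map sum_list Ks = I)"

definition refining_tuple :: "nat list \<Rightarrow> nat list \<Rightarrow> nat list list \<Rightarrow> bool" where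
  "refining_tuple I J Js \<longleftrightarrow> length Js = length I \<and>
     (\<forall>r<length I. Js ! r \<in> compositions (I ! r)) \<and> refines (concat Js) J"

text \<open>The decomposition of \<open>J\<close> relative to \<open>I\<close>, for compositions \<open>I\<close>, \<open>J\<close> of the same number:
  the refining tuple all of whose components are as short as possible.\<close>

definition decomposition :: "nat list \<Rightarrow> nat list \<Rightarrow> nat list list" where
  "decomposition I J = (THE Js. refining_tuple I J Js \<and>
     (\<forall>Ks. refining_tuple I J Ks \<longrightarrow> (\<forall>r<length I. length (Js ! r) \<le> length (Ks ! r))))"

text \<open>The letters \<open>w\<^sub>r\<close>, \<open>1 \<le> r \<le> n\<close>, are the list entries \<open>w ! (r - 1)\<close>.\<close>

definition descent_composition :: "nat list \<Rightarrow> nat list" where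
  "descent_composition w = (THE I. I \<in> compositions (length w) \<and>
     (\<forall>r. 1 \<le> r \<and> r < length w \<longrightarrow>
        (w ! (r - 1) > w ! r \<longleftrightarrow> (\<exists>j. 1 \<le> j \<and> j < length I \<and> r = sum_list (take j I)))))"


section \<open>Power series in countably many commuting variables\<close>

text \<open>Monomials are finitely supported exponent vectors. The variables are indexed from 0.\<close>

typedef power_series = "UNIV :: ((nat \<Rightarrow>\<^sub>0 nat) \<Rightarrow> real) set"
  morphisms coefficient Power_Series ..

lemma coefficient_Power_Series [simp]: "coefficient (Power_Series f) = f"
  by (simp add: Power_Series_inverse)

lemma power_series_eq_iff: "f = g \<longleftrightarrow> (\<forall>m. coefficient f m = coefficient g m)"
  by (metis coefficient_inverse ext)

definition splits :: "(nat \<Rightarrow>\<^sub>0 nat) \<Rightarrow> ((nat \<Rightarrow>\<^sub>0 nat) \<times> (nat \<Rightarrow>\<^sub>0 nat)) set" where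
  "splits m = {(p, q). p + q = m}"

lemma finite_splits: "finite (splits m)"
proof -
  define A where "A = {p :: nat \<Rightarrow>\<^sub>0 nat. \<exists>q. p + q = m}"
  define N where "N = Max (insert 0 (Poly_Mapping.lookup m ` Poly_Mapping.keys m))"
  have bound: "Poly_Mapping.lookup m x \<le> N" for x
  proof (cases "x \<in> Poly_Mapping.keys m")
    case True
    then show ?thesis by (simp add: N_def)
  next
    case False
    then show ?thesis by (simp add: in_keys_iff)
  qed
  have "Poly_Mapping.lookup ` A \<subseteq> {f. \<forall>x. (x \<in> Poly_Mapping.keys m \<longrightarrow> f x \<in> {..N}) \<and> (x \<notin> Poly_Mapping.keys m \<longrightarrow> f x = 0)}"
  proof (clarify, intro conjI impI)
    fix p x assume "p \<in> A"
    then obtain q where q: "p + q = m" by (auto simp: A_def)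
    have le: "Poly_Mapping.lookup p x \<le> Poly_Mapping.lookup m x" by (simp add: q [symmetric] lookup_add)
    then show "Poly_Mapping.lookup p x \<in> {..N}" using bound [of x] by simp
    show "Poly_Mapping.lookup p x = 0" if "x \<notin> Poly_Mapping.keys m" using le that by (simp add: in_keys_iff)
  qed
  moreover have "finite {f. \<forall>x. (x \<in> Poly_Mapping.keys m \<longrightarrow> f x \<in> {..N}) \<and> (x \<notin> Poly_Mapping.keys m \<longrightarrow> f x = 0)}"
    by (rule finite_set_of_finite_funs) auto
  ultimately have "finite (Poly_Mapping.lookup ` A)" by (rule finite_subset)
  then have "finite A" by (rule finite_imageD) (auto intro: inj_onI poly_mapping_eqI)
  moreover have "splits m \<subseteq> (\<lambda>p. (p, m - p)) ` A"
    by (auto simp: splits_def A_def image_iff)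
  ultimately show ?thesis by (meson finite_imageI finite_subset)
qed

instantiation power_series :: "{real_algebra_1, comm_ring_1}"
begin

definition "0 = Power_Series (\<lambda>_. 0)"
definition "1 = Power_Series (\<lambda>m. if m = 0 then 1 else 0)"
definition "f + g = Power_Series (\<lambda>m. coefficient f m + coefficient g m)"
definition "f - g = Power_Series (\<lambda>m. coefficient f m - coefficient g m)"
definition "- f = Power_Series (\<lambda>m. - coefficient f m)"
definition "c *\<^sub>R f = Power_Series (\<lambda>m. c * coefficient f m)"
definition "f * g = Power_Series (\<lambda>m. \<Sum>(p, q)\<in>splits m. coefficient f p * coefficient g q)"

instance
proof
  fix f g h :: power_series and c d :: real
  note defs = zero_power_series_def one_power_series_def plus_power_series_def
    minus_power_series_def uminus_power_series_def scaleR_power_series_def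
    times_power_series_def power_series_eq_iff
  show "f * g * h = f * (g * h)"
  proof -
    have "(\<Sum>(p, q)\<in>splits m. (\<Sum>(u, v)\<in>splits p. coefficient f u * coefficient g v) * coefficient h q)
        = (\<Sum>(p, q)\<in>splits m. coefficient f p * (\<Sum>(u, v)\<in>splits q. coefficient g u * coefficient h v))"
      (is "?L = ?R") for m
    proof -
      have "?L = (\<Sum>x\<in>splits m. \<Sum>y\<in>splits (fst x).
                   coefficient f (fst y) * coefficient g (snd y) * coefficient h (snd x))"
        by (simp add: case_prod_unfold sum_distrib_right)
      also have "\<dots> = (\<Sum>(x, y)\<in>Sigma (splits m) (\<lambda>x. splits (fst x)).
                   coefficient f (fst y) * coefficient g (snd y) * coefficient h (snd x))"
        by (intro sum.Sigma) (auto simp: finite_splits)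
      also have "\<dots> = (\<Sum>(x, y)\<in>Sigma (splits m) (\<lambda>x. splits (snd x)).
                   coefficient f (fst x) * (coefficient g (fst y) * coefficient h (snd y)))"
        by (rule sum.reindex_bij_witness
            [where i = "\<lambda>(x, y). ((fst x + fst y, snd y), (fst x, fst y))"
              and j = "\<lambda>(x, y). ((fst y, snd y + snd x), (snd y, snd x))"])
           (auto simp: splits_def add.assoc mult.assoc)
      also have "\<dots> = (\<Sum>x\<in>splits m. \<Sum>y\<in>splits (snd x).
                   coefficient f (fst x) * (coefficient g (fst y) * coefficient h (snd y)))"
        by (intro sum.Sigma [symmetric]) (auto simp: finite_splits)
      also have "\<dots> = ?R"
        by (simp add: case_prod_unfold sum_distrib_left)
      finally show ?thesis .
    qed
    then show ?thesis by (simp add: defs)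
  qed
  show comm: "f * g = g * f" for f g :: power_series
  proof -
    have "(\<Sum>(p, q)\<in>splits m. coefficient f p * coefficient g q)
        = (\<Sum>(p, q)\<in>splits m. coefficient g p * coefficient f q)" for m
      by (rule sum.reindex_bij_witness [where i = prod.swap and j = prod.swap])
         (auto simp: splits_def add.commute)
    then show ?thesis by (simp add: defs)
  qed
  show one: "1 * f = f"
  proof -
    have "(\<Sum>x\<in>splits m. (if fst x = 0 then 1 else 0) * coefficient f (snd x))
        = (\<Sum>x\<in>{(0 :: nat \<Rightarrow>\<^sub>0 nat, m)}. (if fst x = 0 then 1 else 0) * coefficient f (snd x))" for m
    proof (rule sum.mono_neutral_right [OF finite_splits])
      show "{(0, m)} \<subseteq> splits m" by (simp add: splits_def)
      show "\<forall>x\<in>splits m - {(0, m)}. (if fst x = 0 then 1 else 0) * coefficient f (snd x) = 0"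
        by (auto simp: splits_def)
    qed
    then show ?thesis by (simp add: defs case_prod_unfold)
  qed
  show "f * 1 = f"
    using one by (simp add: comm)
  show "f * (g + h) = f * g + f * h"
    by (simp add: defs case_prod_unfold distrib_left sum.distrib)
  show "(f + g) * h = f * h + g * h"
    by (simp add: defs case_prod_unfold distrib_right sum.distrib)
  show "c *\<^sub>R f * g = c *\<^sub>R (f * g)" "f * c *\<^sub>R g = c *\<^sub>R (f * g)"
    by (simp_all add: defs case_prod_unfold sum_distrib_left mult.assoc mult.left_commute)
  show "(0 :: power_series) \<noteq> 1"
    by (auto simp: defs)
  show "f + g + h = f + (g + h)" "f + g = g + f" "0 + f = f" "- f + f = 0" "f - g = f + - g"
    by (simp_all add: defs)
  show "c *\<^sub>R (f + g) = c *\<^sub>R f + c *\<^sub>R g" "(c + d) *\<^sub>R f = c *\<^sub>R f + d *\<^sub>R f"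
    "c *\<^sub>R d *\<^sub>R f = (c * d) *\<^sub>R f" "1 *\<^sub>R f = f"
    by (simp_all add: defs distrib_left distrib_right mult.assoc)
qed

end


section \<open>Quasisymmetric functions\<close>

text \<open>The coefficient of a monomial in \<open>qsym_M I\<close> counts its representations as
  \<open>x\<^bsub>j\<^sub>1\<^esub>\<^bsup>i\<^sub>1\<^esup> \<cdots> x\<^bsub>j\<^sub>l\<^esub>\<^bsup>i\<^sub>l\<^esup>\<close> with \<open>j\<^sub>1 < \<dots> < j\<^sub>l\<close>; there is at most one when \<open>I\<close> is a composition.\<close>

definition qsym_M :: "nat list \<Rightarrow> power_series" where
  "qsym_M I = Power_Series (\<lambda>m. of_nat (card {js. length js = length I \<and> sorted_wrt (<) js \<and>
     (\<Sum>k<length I. Poly_Mapping.single (js ! k) (I ! k)) = m}))"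

definition qsym_F :: "nat list \<Rightarrow> power_series" where
  "qsym_F I = (\<Sum>J | refines J I. qsym_M J)"

definition QSym :: "power_series set" where
  "QSym = span (qsym_M ` all_compositions)"

lemma lookup_single_sum:
  "Poly_Mapping.lookup (\<Sum>k<length I. Poly_Mapping.single (js ! k) (I ! k)) x
       = (\<Sum>k<length I. if js ! k = x then I ! k else 0)"
  by (simp add: lookup_sum lookup_single when_def)

lemma coefficient_qsym_M_leading:
  assumes "I \<in> all_compositions" "J \<in> all_compositions"
  shows "coefficient (qsym_M I) (\<Sum>k<length J. Poly_Mapping.single k (J ! k))
       = (if I = J then 1 else 0)"
proof -
  have at: "Poly_Mapping.lookup (\<Sum>k<length K. Poly_Mapping.single (js ! k) (K ! k)) (js ! i) = K ! i"
    if "distinct js" "length js = length K" "i < length K" for js K :: "nat list" and i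
  proof -
    have "(\<Sum>k<length K. if js ! k = js ! i then K ! k else 0)
        = (\<Sum>k<length K. if k = i then K ! k else 0)"
      using that by (intro sum.cong) (auto simp: nth_eq_iff_index_eq)
    then show ?thesis using that by (simp add: lookup_single_sum sum.delta)
  qed
  have keys: "Poly_Mapping.keys (\<Sum>k<length K. Poly_Mapping.single (js ! k) (K ! k)) = set js"
    if "distinct js" "length js = length K" "K \<in> all_compositions" for js K :: "nat list"
  proof (intro set_eqI iffI)
    fix x
    assume "x \<in> Poly_Mapping.keys (\<Sum>k<length K. Poly_Mapping.single (js ! k) (K ! k))"
    then have nz: "(\<Sum>k<length K. if js ! k = x then K ! k else 0) \<noteq> 0"
      using that by (simp add: in_keys_iff lookup_single_sum)
    show "x \<in> set js"
    proof (rule ccontr)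
      assume "x \<notin> set js"
      then have "js ! k \<noteq> x" if "k < length K" for k
        using that \<open>length js = length K\<close> nth_mem [of k js] by metis
      then have "(\<Sum>k<length K. if js ! k = x then K ! k else 0) = 0"
        by (intro sum.neutral) auto
      with nz show False by contradiction
    qed
  next
    fix x assume "x \<in> set js"
    then obtain i where "i < length K" "x = js ! i"
      using \<open>length js = length K\<close> by (auto simp: in_set_conv_nth)
    then show "x \<in> Poly_Mapping.keys (\<Sum>k<length K. Poly_Mapping.single (js ! k) (K ! k))"
      using that at [of js K i] by (auto simp: in_keys_iff all_compositions_def)
  qed
  have J: "(\<Sum>k<length J. Poly_Mapping.single k (J ! k))
         = (\<Sum>k<length J. Poly_Mapping.single ([0..<length J] ! k) (J ! k))"
    by (rule sum.cong) auto
  define good where "good js \<longleftrightarrow> length js = length I \<and> sorted_wrt (<) js \<and>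
      (\<Sum>k<length I. Poly_Mapping.single (js ! k) (I ! k))
        = (\<Sum>k<length J. Poly_Mapping.single k (J ! k))" for js
  have unique: "js = [0..<length J] \<and> I = J" if "good js" for js
  proof -
    have len: "length js = length I" and sorted: "sorted_wrt (<) js"
      and eq: "(\<Sum>k<length I. Poly_Mapping.single (js ! k) (I ! k))
             = (\<Sum>k<length J. Poly_Mapping.single ([0..<length J] ! k) (J ! k))"
      using \<open>good js\<close> unfolding good_def J by blast+
    have dist: "distinct js" and srt: "sorted js"
      using sorted by (simp_all add: strict_sorted_iff)
    have set: "set js = set [0..<length J]"
      using keys [OF dist len assms(1)] keys [of "[0..<length J]" J, OF _ _ assms(2)]
      unfolding eq by (metis distinct_upt length_upt minus_nat.diff_0)
    have js: "js = [0..<length J]"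
      by (rule sorted_distinct_set_unique [OF srt dist _ _ set]) auto
    have "I = J"
    proof (rule nth_equalityI)
      show length: "length I = length J" using js len by simp
      fix i assume i: "i < length I"
      have "I ! i = Poly_Mapping.lookup
              (\<Sum>k<length J. Poly_Mapping.single ([0..<length J] ! k) (J ! k)) (js ! i)"
        using at [OF dist len i] unfolding eq by (rule sym)
      also have "\<dots> = J ! i"
        unfolding js using i length by (intro at) auto
      finally show "I ! i = J ! i" .
    qed
    with js show ?thesis by blast
  qed
  have "{js. good js} = (if I = J then {[0..<length J]} else {})"
  proof (cases "I = J")
    case True
    then have "good [0..<length J]" unfolding good_def J by simp
    then have "{js. good js} = {[0..<length J]}" using unique by blast
    then show ?thesis using True by simp
  next
    case False
    then have "{js. good js} = {}" using unique by blast
    then show ?thesis using False by simp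
  qed
  then have "card {js. good js} = (if I = J then 1 else 0)" by simp
  then show ?thesis unfolding qsym_M_def good_def coefficient_Power_Series by simp
qed

lemma inj_on_qsym_M: "inj_on qsym_M all_compositions"
  by (rule inj_onI) (metis coefficient_qsym_M_leading zero_neq_one)

lemma coefficient_scaled_sum:
  "coefficient (\<Sum>x\<in>A. c x *\<^sub>R g x) m = (\<Sum>x\<in>A. c x * coefficient (g x) m)"
  by (induction A rule: infinite_finite_induct)
     (simp_all add: zero_power_series_def plus_power_series_def scaleR_power_series_def)

lemma independent_qsym_M: "independent (qsym_M ` all_compositions)"
proof (rule ccontr)
  assume "\<not> ?thesis"
  then obtain T u v where T: "finite T" "T \<subseteq> qsym_M ` all_compositions"
    and u: "(\<Sum>v\<in>T. u v *\<^sub>R v) = 0" "v \<in> T" "u v \<noteq> 0"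
    by (auto simp: dependent_explicit)
  from T u obtain J where J: "J \<in> all_compositions" "v = qsym_M J" by auto
  let ?m = "\<Sum>k<length J. Poly_Mapping.single k (J ! k)"
  have "(\<Sum>w\<in>T. u w * coefficient w ?m) = (\<Sum>w\<in>T. if w = v then u w else 0)"
    using T J inj_on_qsym_M
    by (intro sum.cong) (auto simp: coefficient_qsym_M_leading inj_on_eq_iff)
  also have "\<dots> = u v" using T u by (simp add: sum.delta)
  finally have "u v = coefficient (\<Sum>v\<in>T. u v *\<^sub>R v) ?m"
    using coefficient_scaled_sum [of u "\<lambda>x. x" T ?m] by simp
  then show False using u by (simp add: zero_power_series_def)
qed

text \<open>Since the \<open>qsym_M I\<close> form a basis of \<open>QSym\<close>, the \<open>a\<close>-th tensor power of \<open>QSym\<close> is the free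
  vector space on \<open>a\<close>-tuples of compositions, the tuple \<open>[I\<^sub>1, \<dots>, I\<^sub>a]\<close> standing for
  \<open>qsym_M I\<^sub>1 \<otimes> \<cdots> \<otimes> qsym_M I\<^sub>a\<close>.\<close>

type_synonym tensor = "nat list list \<Rightarrow>\<^sub>0 real"

text \<open>The identification of \<open>f \<in> QSym\<close> with a tensor of order one.\<close>

definition tensor_of_QSym :: "power_series \<Rightarrow> tensor" where
  "tensor_of_QSym f =
     (let c = (\<lambda>I. representation (qsym_M ` all_compositions) f (qsym_M I))
      in \<Sum>I | I \<in> all_compositions \<and> c I \<noteq> 0. Poly_Mapping.single [I] (c I))"

text \<open>\<open>id \<otimes> \<cdots> \<otimes> id \<otimes> \<Delta>\<close>, extended linearly from the basis tensors; \<open>[I]\<close> is sent to the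
  coproduct of \<open>qsym_M I\<close>.\<close>

definition coproduct_last :: "tensor \<Rightarrow> tensor" where
  "coproduct_last T = (\<Sum>t\<in>Poly_Mapping.keys T. \<Sum>j\<le>length (last t).
     Poly_Mapping.single (butlast t @ [take j (last t), drop j (last t)]) (Poly_Mapping.lookup T t))"

text \<open>The iterated coproduct with values in the \<open>a\<close>-th tensor power, for \<open>a \<ge> 1\<close>.\<close>

definition iterated_coproduct :: "nat \<Rightarrow> power_series \<Rightarrow> tensor" where
  "iterated_coproduct a f = (coproduct_last ^^ (a - 1)) (tensor_of_QSym f)"

definition iterated_product :: "tensor \<Rightarrow> power_series" where
  "iterated_product T = (\<Sum>t\<in>Poly_Mapping.keys T. Poly_Mapping.lookup T t *\<^sub>R prod_list (map qsym_M t))"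

definition hopf_power :: "nat \<Rightarrow> power_series \<Rightarrow> power_series" where
  "hopf_power a f = iterated_product (iterated_coproduct a f)"

text \<open>The matrix \<open>K\<close> with
  \<open>a\<^bsup>-n\<^esup> hopf_power a (qsym_F I) = (\<Sum>J\<in>compositions n. K I J *\<^sub>R qsym_F J)\<close>.\<close>

definition hopf_power_matrix :: "nat \<Rightarrow> nat \<Rightarrow> nat list \<Rightarrow> nat list \<Rightarrow> real" where
  "hopf_power_matrix a n I J =
     representation (qsym_F ` compositions n) ((1 / real a ^ n) *\<^sub>R hopf_power a (qsym_F I)) (qsym_F J)"

definition right_eigenfunction ::
  "'s set \<Rightarrow> ('s \<Rightarrow> 's \<Rightarrow> real) \<Rightarrow> real \<Rightarrow> ('s \<Rightarrow> real) \<Rightarrow> bool" where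
  "right_eigenfunction S K \<beta> f \<longleftrightarrow> (\<forall>x\<in>S. (\<Sum>y\<in>S. K x y * f y) = \<beta> * f x)"


section \<open>Garsia--Reutenauer idempotents\<close>

text \<open>The rational group algebra of the symmetric group on \<open>{1..n}\<close> consists of the elements whose
  keys permute \<open>{1..n}\<close>; only its vector space structure is used.\<close>

type_synonym perm_algebra = "(nat \<Rightarrow> nat) \<Rightarrow>\<^sub>0 rat"

definition scale :: "rat \<Rightarrow> perm_algebra \<Rightarrow> perm_algebra" where
  "scale c x = Poly_Mapping.map ((*) c) x"

definition Des :: "nat \<Rightarrow> (nat \<Rightarrow> nat) \<Rightarrow> nat list" where
  "Des n \<sigma> = descent_composition (map \<sigma> [1..<Suc n])"

definition GR_B :: "nat \<Rightarrow> nat list \<Rightarrow> perm_algebra" where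
  "GR_B n q = (\<Sum>\<sigma> | \<sigma> permutes {1..n} \<and> refines q (Des n \<sigma>). Poly_Mapping.single \<sigma> 1)"

definition GR_I :: "nat \<Rightarrow> nat list \<Rightarrow> perm_algebra" where
  "GR_I n p = (\<Sum>q | refines q p.
     scale (\<Prod>r<length p. (-1) ^ (length (decomposition p q ! r) - 1)
                            / of_nat (length (decomposition p q ! r)))
       (GR_B n q))"

definition GR_E :: "nat \<Rightarrow> nat list \<Rightarrow> perm_algebra" where
  "GR_E n I = scale (1 / fact (length I)) (\<Sum>p | p \<in> compositions n \<and> mset p = mset I. GR_I n p)"


section \<open>The eigenfunctions\<close>

definition eigen_f :: "nat list \<Rightarrow> rat" where
  "eigen_f J = 1 / of_nat (sum_list J) *
     ((-1) ^ (length J - 1) / of_nat ((sum_list J - 1) choose (length J - 1)))"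

definition eigen_fI :: "nat list \<Rightarrow> nat list \<Rightarrow> rat" where
  "eigen_fI I J = 1 / fact (length I) *
     (\<Sum>I' | I' \<in> all_compositions \<and> mset I' = mset I.
        \<Prod>r<length I'. eigen_f (decomposition I' J ! r))"

end

theory Submission
  imports Defs "HOL-Computational_Algebra.Polynomial" "HOL-Library.FuncSet"
begin

text \<open>Both the eigenfunction and the coefficients of \<open>E\<^sub>I\<close> become transparent in the basis \<open>M\<close>. There
  \<open>f\<close> is the functional \<open>M\<^sub>J \<mapsto> (-1)\<^bsup>l - 1\<^esup> / l\<close> with \<open>l = length J\<close>, and
  \<open>f\<^sub>I\<close> averages, over the rearrangements \<open>L\<close> of \<open>I\<close>, the products of these values along the
  cutting of \<open>J\<close> at the divisions of \<open>L\<close>.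

  Since \<open>M\<^sub>J(y, \<dots>, y)\<close> with \<open>m\<close> copies of \<open>y\<close> is \<open>(m choose l) y\<^bsup>|J|\<^esup>\<close>, and \<open>(-1)\<^bsup>l - 1\<^esup> / l\<close> is the
  coefficient of \<open>m\<close> in \<open>m choose l\<close>, the functional attached to \<open>L\<close> evaluates a quasisymmetric
  function at \<open>m\<^sub>1\<close> copies of \<open>y\<^sub>1\<close>, then \<open>m\<^sub>2\<close> copies of \<open>y\<^sub>2\<close> and so on, and extracts the part
  that is multilinear in the \<open>m\<^sub>r\<close> and has exponent \<open>L ! r\<close> in \<open>y\<^sub>r\<close>. Evaluation is
  multiplicative and turns \<open>\<Psi>\<^sup>a\<close> into the \<open>a\<close>-fold repetition of the alphabet. In the repeated
  alphabet multilinearity selects one of the \<open>a\<close> copies of every \<open>y\<^sub>r\<close>; each of the \<open>a\<^sup>k\<close> choices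
  permutes \<open>L\<close> and hence does not change the sum over all rearrangements, which gives the factor
  \<open>a\<^sup>k\<close>.\<close>

section \<open>Refinements and decompositions\<close>

lemma all_compositions_simps [simp]:
  "[] \<in> all_compositions"
  "j # J \<in> all_compositions \<longleftrightarrow> 0 < j \<and> J \<in> all_compositions"
  "J @ K \<in> all_compositions \<longleftrightarrow> J \<in> all_compositions \<and> K \<in> all_compositions"
  by (auto simp: all_compositions_def)

lemma compositions_iff: "J \<in> compositions n \<longleftrightarrow> J \<in> all_compositions \<and> sum_list J = n"
  by (auto simp: compositions_def all_compositions_def)

lemma sum_list_eq_0_composition:
  "J \<in> all_compositions \<Longrightarrow> sum_list J = 0 \<longleftrightarrow> J = []"
  by (cases J) auto

lemma length_le_sum_list: "J \<in> all_compositions \<Longrightarrow> length J \<le> sum_list J"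
  by (induction J) auto

lemma finite_compositions: "finite (compositions n)"
proof (rule finite_subset)
  show "compositions n \<subseteq> {xs. set xs \<subseteq> {..n} \<and> length xs \<le> n}"
    by (auto simp: compositions_iff member_le_sum_list dest: length_le_sum_list)
qed (rule finite_lists_length_le, simp)

lemma refines_Nil [simp]: "refines K [] \<longleftrightarrow> K = []"
  by (auto simp: refines_def)

text \<open>Splitting off the first block of a witness list makes refinement recursive in the
  coarser composition; the later inductions use this form.\<close>

lemma refines_Cons:
  "refines K (j # J) \<longleftrightarrow> 0 < j \<and> (\<exists>A B. K = A @ B \<and> A \<in> compositions j \<and> refines B J)"
proof
  assume "refines K (j # J)"
  then have "\<exists>Ks. concat Ks = K \<and> map sum_list Ks = j # J"
    and comps: "K \<in> all_compositions" "0 < j" "J \<in> all_compositions"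
    unfolding refines_def by simp_all
  then obtain Ks where Ks: "concat Ks = K" "map sum_list Ks = j # J" by (elim exE conjE)
  then obtain A Bs where AB: "Ks = A # Bs" by (cases Ks) auto
  then have "refines (concat Bs) J" "A \<in> compositions j" "K = A @ concat Bs"
    using Ks comps unfolding refines_def compositions_iff by auto
  with comps show "0 < j \<and> (\<exists>A B. K = A @ B \<and> A \<in> compositions j \<and> refines B J)"
    by blast
next
  assume "0 < j \<and> (\<exists>A B. K = A @ B \<and> A \<in> compositions j \<and> refines B J)"
  then obtain A Bs where "K = A @ concat Bs" "A \<in> compositions j" "0 < j"
      "refines (concat Bs) J" "map sum_list Bs = J"
    by (auto simp: refines_def)
  then show "refines K (j # J)"
    by (auto simp: refines_def compositions_iff intro!: exI [of _ "A # Bs"])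
qed

lemma refines_ConsI:
  "A \<in> compositions j \<Longrightarrow> 0 < j \<Longrightarrow> refines B J \<Longrightarrow> refines (A @ B) (j # J)"
  by (auto simp: refines_Cons)

lemma refines_refl: "J \<in> all_compositions \<Longrightarrow> refines J J"
proof (induction J)
  case (Cons j J)
  then show ?case
    using refines_ConsI [of "[j]" j J J] by (simp add: compositions_iff)
qed simp

lemma sum_list_concat_map: "sum_list (concat Ks) = sum_list (map sum_list Ks)"
  by (induction Ks) auto

lemma sum_list_refines: "refines K J \<Longrightarrow> sum_list K = sum_list J"
  by (auto simp: refines_def sum_list_concat_map)

lemma refines_compositions: "refines K J \<Longrightarrow> K \<in> compositions (sum_list J)"
  using sum_list_refines by (auto simp: compositions_iff refines_def)

lemma finite_refinements: "finite {K. refines K J}"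
  by (rule finite_subset [OF _ finite_compositions [of "sum_list J"]])
     (auto dest: refines_compositions)

lemma length_refines: "refines K J \<Longrightarrow> length J \<le> length K"
proof (induction J arbitrary: K)
  case (Cons j J)
  then obtain A B where "K = A @ B" "A \<in> compositions j" "refines B J" "0 < j"
    by (auto simp: refines_Cons)
  moreover then have "A \<noteq> []" by (auto simp: compositions_iff)
  ultimately show ?case using Cons.IH [of B] by (cases A) auto
qed auto

text \<open>Every part of \<open>J\<close> is replaced by a nonempty block, so without extra length
  all blocks consist of one part.\<close>

lemma refines_same_length:
  "refines K J \<Longrightarrow> length K \<le> length J \<Longrightarrow> K = J"
proof (induction J arbitrary: K)
  case (Cons j J)
  then obtain A B where K: "K = A @ B" "A \<in> compositions j" "refines B J" "0 < j"
    by (auto simp: refines_Cons)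
  then obtain x A' where A: "A = x # A'" by (cases A) (auto simp: compositions_iff)
  have "length J \<le> length B" using K length_refines by auto
  moreover have "length A' + length B \<le> length J" using Cons.prems(2) K A by simp
  ultimately have "length A' = 0" "length B \<le> length J" by linarith+
  then have "A' = []" by simp
  with Cons.IH [of B] K A \<open>length B \<le> length J\<close> show ?case by (auto simp: compositions_iff)
qed auto

lemma refines_antisym: "refines K J \<Longrightarrow> refines J K \<Longrightarrow> K = J"
  by (auto intro: refines_same_length length_refines)

section \<open>Cutting a composition at prescribed divisions\<close>

text \<open>These are the dots up to position \<open>i\<close>, a part straddling that position
  being cut in two; \<open>remaining\<close> keeps the rest. The test \<open>i = 0\<close> prevents
  a final part 0.\<close>

fun initial :: "nat \<Rightarrow> nat list \<Rightarrow> nat list" where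
  "initial i [] = []"
| "initial i (j # J) = (if i = 0 then [] else if j \<le> i then j # initial (i - j) J else [i])"

fun remaining :: "nat \<Rightarrow> nat list \<Rightarrow> nat list" where
  "remaining i [] = []"
| "remaining i (j # J) = (if j \<le> i then remaining (i - j) J else (j - i) # J)"

lemma initial_composition:
  "J \<in> all_compositions \<Longrightarrow> i \<le> sum_list J \<Longrightarrow> initial i J \<in> compositions i"
  by (induction i J rule: initial.induct) (auto simp: compositions_iff)

lemma remaining_composition:
  "J \<in> all_compositions \<Longrightarrow> i \<le> sum_list J \<Longrightarrow> remaining i J \<in> compositions (sum_list J - i)"
  by (induction i J rule: remaining.induct) (auto simp: compositions_iff)

lemma initial_0 [simp]: "initial 0 J = []"
  by (cases J) auto

lemma remaining_0: "J \<in> all_compositions \<Longrightarrow> remaining 0 J = J"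
  by (cases J) auto

lemma initial_append: "K @ L \<in> all_compositions \<Longrightarrow> initial (sum_list K) (K @ L) = K"
  by (induction K) auto

lemma remaining_append: "K @ L \<in> all_compositions \<Longrightarrow> remaining (sum_list K) (K @ L) = L"
  by (induction K) (auto simp: remaining_0)

text \<open>A refinement of \<open>J\<close> with a division at \<open>sum_list K\<close> still
  refines \<open>J\<close> after that division is inserted, and can then be tested on the two sides
  separately. The induction distinguishes whether the first part of \<open>J\<close> ends within
  \<open>K\<close> or reaches beyond it.\<close>

lemma refines_append_iff:
  assumes "J \<in> all_compositions" "K \<in> all_compositions" "sum_list K \<le> sum_list J"
  shows "refines (K @ L) J \<longleftrightarrow>
    refines K (initial (sum_list K) J) \<and> refines L (remaining (sum_list K) J)"
  using assms
proof (induction J arbitrary: K L)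
  case (Cons j J)
  show ?case
  proof (cases "K = []")
    case False
    then have pos: "sum_list K \<noteq> 0" using Cons.prems by (simp only: sum_list_eq_0_composition) simp
    show ?thesis
    proof (cases "j \<le> sum_list K")
      case True
      have "refines (K @ L) (j # J) \<longleftrightarrow> (\<exists>A K'. K = A @ K' \<and> A \<in> compositions j \<and> refines (K' @ L) J)"
        (is "?L \<longleftrightarrow> ?R")
      proof
        assume ?L
        then obtain A B where AB: "K @ L = A @ B" "A \<in> compositions j" "refines B J"
          by (auto simp: refines_Cons)
        from AB(1) obtain us where "K = A @ us \<and> us @ L = B \<or> K @ us = A \<and> L = us @ B"
          by (auto simp: append_eq_append_conv2)
        then show ?R
        proof
          \<comment> \<open>The sum of \<open>K\<close> is already at least \<open>j\<close>, so the
            overhang \<open>us\<close> has sum 0 and is empty.\<close>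
          assume us: "K @ us = A \<and> L = us @ B"
          with AB True have "us \<in> all_compositions" "sum_list us = 0"
            by (auto simp: compositions_iff)
          then have "us = []" using sum_list_eq_0_composition by blast
          with us AB show ?R by (intro exI [of _ K] exI [of _ "[]"]) auto
        qed (use AB in blast)
      next
        assume ?R
        then obtain A K' where "K = A @ K'" "A \<in> compositions j" "refines (K' @ L) J" by blast
        then show ?L using Cons.prems refines_ConsI [of A j "K' @ L" J] by simp
      qed
      also have "\<dots> \<longleftrightarrow> (\<exists>A K'. K = A @ K' \<and> A \<in> compositions j \<and>
          refines K' (initial (sum_list K - j) J)) \<and> refines L (remaining (sum_list K - j) J)"
      proof -
        have "refines (K' @ L) J \<longleftrightarrow> refines K' (initial (sum_list K - j) J)
            \<and> refines L (remaining (sum_list K - j) J)" if "K = A @ K'" "A \<in> compositions j" for A K'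
          using Cons.IH [of K' L] Cons.prems that by (simp add: compositions_iff)
        then show ?thesis by blast
      qed
      also have "\<dots> \<longleftrightarrow> refines K (initial (sum_list K) (j # J)) \<and> refines L (remaining (sum_list K) (j # J))"
        using True pos Cons.prems by (auto simp: refines_Cons)
      finally show ?thesis .
    next
      case False
      have "refines (K @ L) (j # J) \<longleftrightarrow> (\<exists>A' B. L = A' @ B \<and> A' \<in> compositions (j - sum_list K) \<and> refines B J)"
        (is "?L \<longleftrightarrow> ?R")
      proof
        assume ?L
        then obtain A B where AB: "K @ L = A @ B" "A \<in> compositions j" "refines B J"
          by (auto simp: refines_Cons)
        from AB(1) obtain us where "K = A @ us \<and> us @ L = B \<or> K @ us = A \<and> L = us @ B"
          by (auto simp: append_eq_append_conv2)
        then show ?R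
        proof
          assume us: "K = A @ us \<and> us @ L = B"
          with AB False show ?R by (auto simp: compositions_iff)
        next
          assume us: "K @ us = A \<and> L = us @ B"
          with AB False have "us \<in> compositions (j - sum_list K)" by (auto simp: compositions_iff)
          with us AB show ?R by blast
        qed
      next
        assume ?R
        then obtain A' B where "L = A' @ B" "A' \<in> compositions (j - sum_list K)" "refines B J" by blast
        then show ?L
          using Cons.prems False refines_ConsI [of "K @ A'" j B J] by (simp add: compositions_iff)
      qed
      moreover have "refines K [sum_list K]"
        using Cons.prems(2) pos refines_ConsI [of K "sum_list K" "[]" "[]"]
        by (simp only: compositions_iff append_Nil2 refines_Nil)
      ultimately show ?thesis
        using False pos by (simp add: refines_Cons del: sum_list_eq_0_iff)
    qed
  qed (use Cons.prems in \<open>auto simp: remaining_0\<close>)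
qed (use sum_list_eq_0_composition in auto)

text \<open>For equal sums this is the coarsest common refinement of \<open>I\<close> and
  \<open>J\<close>, grouped by the parts of \<open>I\<close>.\<close>

fun cut_at :: "nat list \<Rightarrow> nat list \<Rightarrow> nat list list" where
  "cut_at [] J = []"
| "cut_at (i # I) J = initial i J # cut_at I (remaining i J)"

lemma length_cut_at [simp]: "length (cut_at I J) = length I"
  by (induction I arbitrary: J) auto

lemma cut_at_composition:
  "J \<in> all_compositions \<Longrightarrow> sum_list I = sum_list J \<Longrightarrow> r < length I \<Longrightarrow>
    cut_at I J ! r \<in> compositions (I ! r)"
proof (induction I arbitrary: J r)
  case (Cons i I)
  show ?case
    using Cons.prems Cons.IH [of "remaining i J" "r - 1"] initial_composition [of J i]
      remaining_composition [of J i]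
    by (cases r) (auto simp: compositions_iff)
qed auto

lemma map_sum_list_cut_at:
  "J \<in> all_compositions \<Longrightarrow> sum_list I = sum_list J \<Longrightarrow> map sum_list (cut_at I J) = I"
  by (rule nth_equalityI) (auto dest: cut_at_composition simp: compositions_iff)

lemma cut_at_concat:
  "concat Ks \<in> all_compositions \<Longrightarrow> cut_at (map sum_list Ks) (concat Ks) = Ks"
  by (induction Ks) (auto simp: initial_append remaining_append)

lemma map_sum_list_eq_iff:
  "map sum_list Js = I \<longleftrightarrow> length Js = length I \<and> (\<forall>r<length I. sum_list (Js ! r) = I ! r)"
  by (auto simp: list_eq_iff_nth_eq)

lemma refining_tuple_altdef:
  "refining_tuple I J Js \<longleftrightarrow> map sum_list Js = I \<and> refines (concat Js) J"
proof
  assume "map sum_list Js = I \<and> refines (concat Js) J"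
  moreover from this have "\<forall>x\<in>set Js. x \<in> all_compositions"
    by (auto simp: refines_def all_compositions_def)
  ultimately show "refining_tuple I J Js"
    by (auto simp: refining_tuple_def compositions_iff)
qed (auto simp: refining_tuple_def map_sum_list_eq_iff compositions_iff)

text \<open>This iterates the two-sided criterion \<open>refines_append_iff\<close> over the
  divisions of \<open>I\<close>.\<close>

lemma refining_tuple_iff_cut_at:
  assumes "J \<in> all_compositions" "sum_list I = sum_list J"
  shows "refining_tuple I J Js \<longleftrightarrow> list_all2 refines Js (cut_at I J)"
  using assms
proof (induction I arbitrary: J Js)
  case Nil
  then have "J = []" using sum_list_eq_0_composition [of J] by simp
  then show ?case by (auto simp: refining_tuple_altdef)
next
  case (Cons i I)
  show ?case
  proof (cases Js)
    case (Cons A As)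
    have rem: "remaining i J \<in> compositions (sum_list J - i)"
      using Cons.prems by (intro remaining_composition) auto
    have ini: "initial i J \<in> compositions i"
      using Cons.prems by (intro initial_composition) auto
    have "refining_tuple (i # I) J Js \<longleftrightarrow>
        sum_list A = i \<and> refines A (initial i J) \<and> refining_tuple I (remaining i J) As"
    proof (cases "A \<in> all_compositions")
      case True
      then show ?thesis
        using Cons.prems refines_append_iff [of J A "concat As"] \<open>Js = A # As\<close>
        by (auto simp: refining_tuple_altdef)
    qed (auto simp: refining_tuple_altdef refines_def \<open>Js = A # As\<close>)
    also have "\<dots> \<longleftrightarrow> refines A (initial i J) \<and> list_all2 refines As (cut_at I (remaining i J))"
      using Cons.IH [of "remaining i J" As] rem ini Cons.prems sum_list_refines [of A "initial i J"]
      by (auto simp: compositions_iff)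
    finally show ?thesis using Cons by simp
  qed (auto simp: refining_tuple_altdef)
qed

text \<open>The cut is itself a refining tuple and all others refine it componentwise. Refinement
  never shortens, so the cut is minimal in every component; refinement without added length is
  equality, so the minimum is unique.\<close>

lemma decomposition_eq_cut_at:
  assumes "J \<in> all_compositions" "sum_list I = sum_list J"
  shows "decomposition I J = cut_at I J"
  unfolding decomposition_def
proof (rule the_equality)
  note iff = refining_tuple_iff_cut_at [OF assms]
  have self: "refining_tuple I J (cut_at I J)"
    unfolding iff using cut_at_composition [OF assms]
    by (auto simp: list_all2_conv_all_nth compositions_iff refines_refl)
  then show "refining_tuple I J (cut_at I J) \<and>
      (\<forall>Ks. refining_tuple I J Ks \<longrightarrow> (\<forall>r<length I. length (cut_at I J ! r) \<le> length (Ks ! r)))"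
    by (auto simp: iff list_all2_conv_all_nth length_refines)
  fix Js
  assume Js: "refining_tuple I J Js \<and>
      (\<forall>Ks. refining_tuple I J Ks \<longrightarrow> (\<forall>r<length I. length (Js ! r) \<le> length (Ks ! r)))"
  then have "\<forall>r<length I. length (Js ! r) \<le> length (cut_at I J ! r)" using self by blast
  with Js show "Js = cut_at I J"
    by (auto simp: iff list_all2_conv_all_nth intro!: nth_equalityI refines_same_length)
qed

text \<open>The value at \<open>[]\<close> is 0 because \<open>x / 0 = 0\<close>; this agrees with the linear coefficient of the
  constant polynomial \<open>m choose 0\<close>, so \<open>coeff_1_binomial_poly\<close> needs no case distinction.\<close>

definition log_weight :: "nat list \<Rightarrow> 'a::field_char_0" where
  "log_weight J = (-1) ^ (length J - 1) / of_nat (length J)"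

text \<open>The value at M_K of the functional attached to \<open>L\<close>. For compositions at
  most one \<open>Ks\<close> contributes, and none unless \<open>K\<close> refines \<open>L\<close>.
  The field is left open because the idempotents need rationals and the power series need
  reals.\<close>

definition split_weight :: "nat list \<Rightarrow> nat list \<Rightarrow> 'a::field_char_0" where
  "split_weight L K = (\<Sum>Ks | concat Ks = K \<and> map sum_list Ks = L. prod_list (map log_weight Ks))"

text \<open>These tuples index the iterated coproduct of M_J; empty pieces are allowed.\<close>

definition cuts :: "nat \<Rightarrow> nat list \<Rightarrow> nat list list set" where
  "cuts N J = {Js. length Js = N \<and> concat Js = J}"

lemma cuts_0: "cuts 0 J = (if J = [] then {[]} else {})"
  by (auto simp: cuts_def)

lemma cuts_Suc: "cuts (Suc N) J = (\<Union>j\<in>{..length J}. (#) (take j J) ` cuts N (drop j J))"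
proof (intro equalityI subsetI)
  fix Js assume "Js \<in> cuts (Suc N) J"
  then obtain A As where "Js = A # As" "length As = N" "A @ concat As = J"
    by (auto simp: cuts_def length_Suc_conv)
  then show "Js \<in> (\<Union>j\<in>{..length J}. (#) (take j J) ` cuts N (drop j J))"
    by (intro UN_I [of "length A"] image_eqI [of _ _ As]) (auto simp: cuts_def)
qed (auto simp: cuts_def)

lemma finite_cuts: "finite (cuts N J)"
  by (induction N arbitrary: J) (auto simp: cuts_0 cuts_Suc)

lemma sum_cuts_Suc:
  "(\<Sum>Js\<in>cuts (Suc N) J. g Js) = (\<Sum>j\<le>length J. \<Sum>Js\<in>cuts N (drop j J). g (take j J # Js))"
proof -
  have "(\<Sum>Js\<in>cuts (Suc N) J. g Js) = (\<Sum>j\<le>length J. \<Sum>Js\<in>(#) (take j J) ` cuts N (drop j J). g Js)"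
    unfolding cuts_Suc
  proof (rule sum.UNION_disjoint)
    show "\<forall>i\<in>{..length J}. \<forall>j\<in>{..length J}. i \<noteq> j \<longrightarrow>
        (#) (take i J) ` cuts N (drop i J) \<inter> (#) (take j J) ` cuts N (drop j J) = {}"
    proof (intro ballI impI equals0I)
      fix i j x assume "i \<in> {..length J}" "j \<in> {..length J}" "i \<noteq> j"
        "x \<in> (#) (take i J) ` cuts N (drop i J) \<inter> (#) (take j J) ` cuts N (drop j J)"
      then have "take i J = take j J" "i \<le> length J" "j \<le> length J" by auto
      from arg_cong [OF this(1), of length] this(2,3) \<open>i \<noteq> j\<close> show False by simp
    qed
  qed (auto simp: finite_cuts)
  also have "\<dots> = (\<Sum>j\<le>length J. \<Sum>Js\<in>cuts N (drop j J). g (take j J # Js))"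
    by (simp add: sum.reindex)
  finally show ?thesis .
qed

lemma splits_along_subset_cuts:
  "{Ks. concat Ks = K \<and> map sum_list Ks = L} \<subseteq> cuts (length L) K"
  by (auto simp: cuts_def)

lemma split_weight_eq:
  assumes "K \<in> all_compositions" "sum_list K = sum_list L" "L \<in> all_compositions"
  shows "split_weight L K = (if refines K L then prod_list (map log_weight (cut_at L K)) else 0)"
proof -
  have "{Ks. concat Ks = K \<and> map sum_list Ks = L} = (if refines K L then {cut_at L K} else {})"
    using assms cut_at_concat by (auto simp: refines_def) (metis cut_at_concat)
  then show ?thesis by (simp add: split_weight_def)
qed

lemma sum_list_all2_refines:
  fixes g :: "nat list \<Rightarrow> 'a::comm_semiring_1"
  shows "(\<Sum>Ks | list_all2 refines Ks Ds. prod_list (map g Ks))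
      = prod_list (map (\<lambda>D. \<Sum>K | refines K D. g K) Ds)"
proof (induction Ds)
  case (Cons D Ds)
  have "{Ks. list_all2 refines Ks (D # Ds)}
      = (\<lambda>(K, Ks). K # Ks) ` ({K. refines K D} \<times> {Ks. list_all2 refines Ks Ds})"
    by (auto simp: list_all2_Cons2)
  then have "(\<Sum>Ks | list_all2 refines Ks (D # Ds). prod_list (map g Ks))
      = (\<Sum>(K, Ks)\<in>{K. refines K D} \<times> {Ks. list_all2 refines Ks Ds}. g K * prod_list (map g Ks))"
    by (simp add: sum.reindex inj_on_def case_prod_unfold)
  then show ?case
    unfolding list.map prod_list.Cons Cons [symmetric] sum_product sum.cartesian_product .
qed auto

text \<open>A refinement \<open>K\<close> of \<open>J\<close> together with a cutting of
  \<open>K\<close> along \<open>L\<close> is a refining tuple, that is, an independent refinement of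
  each piece of \<open>cut_at L J\<close>. The sum of products therefore factors.\<close>

lemma sum_split_weight_refinements:
  assumes "J \<in> all_compositions" "sum_list L = sum_list J"
  shows "(\<Sum>K | refines K J. split_weight L K)
      = prod_list (map (\<lambda>D. \<Sum>K | refines K D. log_weight K) (cut_at L J))"
proof -
  have "(\<Sum>K | refines K J. split_weight L K) =
      (\<Sum>Ks\<in>(\<Union>K\<in>{K. refines K J}. {Ks. concat Ks = K \<and> map sum_list Ks = L}). prod_list (map log_weight Ks))"
    unfolding split_weight_def
    by (rule sum.UNION_disjoint [symmetric])
       (auto simp: finite_refinements intro: finite_subset [OF splits_along_subset_cuts finite_cuts])
  also have "(\<Union>K\<in>{K. refines K J}. {Ks. concat Ks = K \<and> map sum_list Ks = L})
      = {Ks. list_all2 refines Ks (cut_at L J)}"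
    using refining_tuple_iff_cut_at [OF assms] by (auto simp: refining_tuple_altdef)
  finally show ?thesis by (simp add: sum_list_all2_refines)
qed

section \<open>Refinements of a composition counted by length\<close>

lemma refinements_Cons_1: "{K. refines K (1 # D)} = (#) 1 ` {K. refines K D}"
proof -
  have "A \<in> compositions 1 \<longleftrightarrow> A = [1]" for A
  proof
    assume "A \<in> compositions 1"
    then show "A = [1]"
    proof (cases A)
      case (Cons x A')
      then have "0 < x" "A' \<in> all_compositions" "x + sum_list A' = 1"
        using \<open>A \<in> compositions 1\<close> by (simp_all add: compositions_iff)
      then have "x = 1 \<and> A' \<in> all_compositions \<and> sum_list A' = 0" by linarith
      then show ?thesis using Cons sum_list_eq_0_composition [of A'] by simp
    qed (use \<open>A \<in> compositions 1\<close> in \<open>simp add: compositions_iff\<close>)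
  qed (auto simp: compositions_iff)
  then show ?thesis by (auto simp: refines_Cons)
qed

text \<open>A composition of \<open>Suc d\<close> either begins with 1 or arises from a composition
  of \<open>d\<close> by enlarging its first part, a form of Pascal's rule.\<close>

lemma refinements_Cons_Suc:
  assumes "0 < d"
  shows "{K. refines K (Suc d # D)} = (#) 1 ` {K. refines K (d # D)}
      \<union> (\<lambda>K. Suc (hd K) # tl K) ` {K. refines K (d # D)}" (is "?L = ?R")
proof (intro equalityI subsetI)
  fix K assume "K \<in> ?L"
  then obtain A B where K: "K = A @ B" "A \<in> compositions (Suc d)" "refines B D"
    by (auto simp: refines_Cons)
  then obtain x A' where A: "A = x # A'" by (cases A) (auto simp: compositions_iff)
  show "K \<in> ?R"
  proof (cases "x = 1")
    case True
    then have "refines (A' @ B) (d # D)"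
      using K A assms by (auto simp: refines_Cons compositions_iff)
    then show ?thesis using K A True by auto
  next
    case False
    then have "refines ((x - 1) # A' @ B) (d # D)"
      using K A assms refines_ConsI [of "(x - 1) # A'" d B D] by (auto simp: compositions_iff)
    then show ?thesis using K A False
      by (intro UnI2 image_eqI [of _ _ "(x - 1) # A' @ B"]) (auto simp: compositions_iff)
  qed
next
  fix K assume "K \<in> ?R"
  then obtain K' where K': "refines K' (d # D)" "K = 1 # K' \<or> K = Suc (hd K') # tl K'" by auto
  then obtain A B where AB: "K' = A @ B" "A \<in> compositions d" "refines B D"
    by (auto simp: refines_Cons)
  then obtain x A' where A: "A = x # A'" using assms by (cases A) (auto simp: compositions_iff)
  from K'(2) have "K = (1 # A) @ B \<or> K = (Suc x # A') @ B" using AB A by auto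
  then show "K \<in> ?L"
    using AB A refines_ConsI [of "1 # A" "Suc d" B D] refines_ConsI [of "Suc x # A'" "Suc d" B D]
    by (auto simp: compositions_iff)
qed

text \<open>The recursion of \<open>h\<close> is that of \<open>h l s = \<phi> (x\<^sup>l (1 + x)\<^sup>s)\<close> for a linear functional \<open>\<phi>\<close>; the
  polynomial \<open>x\<^sup>l (1 + x)\<^sup>s\<close> enumerates the refinements of \<open>D\<close> by length.\<close>

lemma sum_length_refinements:
  fixes h :: "nat \<Rightarrow> nat \<Rightarrow> 'a::comm_monoid_add"
  assumes h: "\<And>l s. 0 < l \<Longrightarrow> h l (Suc s) = h l s + h (Suc l) s"
    and "D \<in> all_compositions" "D \<noteq> []"
  shows "(\<Sum>K | refines K D. h (length K + t) 0) = h (length D + t) (sum_list D - length D)"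
  using assms(2,3)
proof (induction "sum_list D" arbitrary: D t)
  case 0
  then show ?case using sum_list_eq_0_composition [of D] by simp
next
  case (Suc n)
  then obtain d D' where D: "D = d # D'" "0 < d" "D' \<in> all_compositions" by (cases D) auto
  show ?case
  proof (cases "d = 1")
    \<comment> \<open>A leading part 1 survives in every refinement; removing it is recorded by
      raising \<open>t\<close>.\<close>
    case True
    then have "(\<Sum>K | refines K D. h (length K + t) 0) = (\<Sum>K | refines K D'. h (length K + Suc t) 0)"
      unfolding D(1) True refinements_Cons_1 by (subst sum.reindex) auto
    also have "\<dots> = h (length D' + Suc t) (sum_list D' - length D')"
    proof (cases "D' = []")
      case False
      then show ?thesis using Suc.hyps(1) [of D' "Suc t"] Suc.hyps(2) D True by simp
    qed auto
    finally show ?thesis using D True by simp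
  next
    case False
    then obtain e where e: "d = Suc e" "0 < e" using D by (cases d) auto
    let ?R = "{K. refines K (e # D')}"
    have ne: "K \<noteq> []" "0 < hd K" if "K \<in> ?R" for K
      using that by (cases K; auto simp: refines_def)+
    have inj: "inj_on (\<lambda>K. Suc (hd K) # tl K) ?R"
      by (rule inj_onI) (metis ne(1) list.collapse list.inject nat.inject)
    have "(\<Sum>K | refines K D. h (length K + t) 0)
        = (\<Sum>K\<in>(#) 1 ` ?R. h (length K + t) 0) + (\<Sum>K\<in>(\<lambda>K. Suc (hd K) # tl K) ` ?R. h (length K + t) 0)"
      unfolding D(1) e(1) refinements_Cons_Suc [OF e(2)]
    proof (rule sum.union_disjoint)
      show "(#) 1 ` ?R \<inter> (\<lambda>K. Suc (hd K) # tl K) ` ?R = {}"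
        using ne(2) by fastforce
    qed (simp_all add: finite_refinements)
    also have "\<dots> = (\<Sum>K\<in>?R. h (length K + Suc t) 0) + (\<Sum>K\<in>?R. h (length K + t) 0)"
    proof (rule arg_cong2 [where f = "(+)"])
      show "(\<Sum>K\<in>(\<lambda>K. Suc (hd K) # tl K) ` ?R. h (length K + t) 0) = (\<Sum>K\<in>?R. h (length K + t) 0)"
      proof (subst sum.reindex [OF inj], rule sum.cong [OF refl])
        fix K assume "K \<in> ?R"
        then show "((\<lambda>K. h (length K + t) 0) \<circ> (\<lambda>K. Suc (hd K) # tl K)) K = h (length K + t) 0"
          using ne(1) [of K] by (cases K) auto
      qed
    qed (subst sum.reindex, auto)
    also have "\<dots> = h (Suc (length D' + Suc t)) (e + sum_list D' - Suc (length D'))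
                + h (Suc (length D' + t)) (e + sum_list D' - Suc (length D'))"
      using Suc.hyps(1) [of "e # D'" t] Suc.hyps(1) [of "e # D'" "Suc t"] Suc.hyps(2) D e by simp
    also have "\<dots> = h (Suc (length D' + t)) (Suc (e + sum_list D' - Suc (length D')))"
      by (subst h) (auto simp: add.commute)
    also have "Suc (e + sum_list D' - Suc (length D')) = Suc e + sum_list D' - Suc (length D')"
      using length_le_sum_list [OF D(3)] e by simp
    finally show ?thesis using D e by simp
  qed
qed

lemma sum_log_weight_refinements:
  assumes "D \<in> all_compositions" "D \<noteq> []"
  shows "(\<Sum>K | refines K D. log_weight K) = eigen_f D"
proof -
  \<comment> \<open>\<open>h l s\<close> is the integral of x^(l-1) (1+x)^s over [-1,0], a Beta
    value. At \<open>s = 0\<close> it is the logarithmic weight of length \<open>l\<close>; at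
    \<open>l = length D\<close>, \<open>s = sum_list D - length D\<close> it is
    \<open>eigen_f D\<close>.\<close>
  define h :: "nat \<Rightarrow> nat \<Rightarrow> rat" where
    "h l s = (-1) ^ (l - 1) * fact (l - 1) * fact s / fact (l + s)" for l s
  have step: "h l (Suc s) = h l s + h (Suc l) s" if "0 < l" for l s
  proof -
    obtain k where l: "l = Suc k" using \<open>0 < l\<close> gr0_implies_Suc by blast
    define F :: rat where "F = fact (k + s)"
    have F: "F \<noteq> 0" by (simp add: F_def)
    have "of_nat k + of_nat s + (1::rat) \<noteq> 0" "of_nat k + of_nat s + (2::rat) \<noteq> 0"
      using of_nat_neq_0 [of "k + s", where 'a = rat] of_nat_neq_0 [of "k + s + 1", where 'a = rat]
      by (auto simp: algebra_simps)
    then show ?thesis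
      unfolding h_def l using F
      by (simp add: F_def [symmetric] divide_simps) (auto simp: algebra_simps)
  qed
  have "log_weight K = h (length K + 0) 0" if "refines K D" for K
  proof -
    have "length K \<noteq> 0" using length_refines [OF that] assms by auto
    then show ?thesis by (cases "length K") (auto simp: log_weight_def h_def)
  qed
  then have "(\<Sum>K | refines K D. log_weight K) = h (length D + 0) (sum_list D - length D)"
    using sum_length_refinements [of h D 0, OF step assms] by simp
  also have "\<dots> = eigen_f D"
  proof -
    obtain l where l: "length D = Suc l" using assms(2) by (cases "length D") auto
    obtain m where m: "sum_list D = Suc m" "l \<le> m"
      using length_le_sum_list [OF assms(1)] l by (metis Suc_le_D Suc_le_mono)
    show ?thesis
      using m l by (simp add: h_def eigen_f_def binomial_fact divide_simps) 
  qed
  finally show ?thesis .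
qed

lemma prod_list_eq_prod_nth: "prod_list xs = (\<Prod>i<length xs. xs ! i)"
  by (induction xs) (simp_all add: prod.lessThan_Suc_shift del: prod.lessThan_Suc)

text \<open>Since F_J is the sum of M_K over the refinements \<open>K\<close> of \<open>J\<close>, a
  summand of f_I is the value at F_J of the functional attached to \<open>L\<close>.\<close>

lemma sum_split_weight_refinements_eigen:
  assumes "J \<in> all_compositions" "L \<in> all_compositions" "sum_list L = sum_list J"
  shows "(\<Sum>K | refines K J. split_weight L K) = (\<Prod>r<length L. eigen_f (decomposition L J ! r))"
proof -
  have "(\<Prod>r<length L. eigen_f (decomposition L J ! r)) = prod_list (map eigen_f (cut_at L J))"
    by (simp add: decomposition_eq_cut_at assms prod_list_eq_prod_nth)
  also have "map eigen_f (cut_at L J) = map (\<lambda>D. \<Sum>K | refines K D. log_weight K) (cut_at L J)"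
  proof (rule nth_equalityI)
    fix r assume "r < length (map eigen_f (cut_at L J))"
    \<comment> \<open>The parts of \<open>L\<close> are positive, so no piece is empty and
      \<open>sum_log_weight_refinements\<close> applies to each.\<close>
    then have "r < length L" "0 < L ! r" using assms by (auto simp: all_compositions_def)
    with cut_at_composition [OF assms(1,3), of r]
    have "cut_at L J ! r \<in> all_compositions" "cut_at L J ! r \<noteq> []"
      by (auto simp: compositions_iff)
    then show "map eigen_f (cut_at L J) ! r
        = map (\<lambda>D. \<Sum>K | refines K D. log_weight K) (cut_at L J) ! r"
      using \<open>r < length L\<close> by (simp add: sum_log_weight_refinements)
  qed simp
  finally show ?thesis
    using assms by (simp add: sum_split_weight_refinements)
qed

section \<open>Descents and the idempotents\<close>

text \<open>The classical encoding of a composition of n by a subset of \<open>{1..<n}\<close>; the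
  bound \<open>j < length I\<close> excludes n itself.\<close>

definition breaks :: "nat list \<Rightarrow> nat set" where
  "breaks I = {sum_list (take j I) | j. 1 \<le> j \<and> j < length I}"

lemma breaks_Cons: "breaks (i # I) = (if I = [] then {} else insert i ((+) i ` breaks I))"
proof (cases "I = []")
  case False
  have "x \<in> breaks (i # I) \<longleftrightarrow> x \<in> insert i ((+) i ` breaks I)" for x
  proof
    assume "x \<in> breaks (i # I)"
    then obtain j where j: "x = sum_list (take j (i # I))" "1 \<le> j" "j < Suc (length I)"
      by (auto simp: breaks_def)
    then obtain k where k: "j = Suc k" by (cases j) auto
    show "x \<in> insert i ((+) i ` breaks I)"
    proof (cases "k = 0")
      case False
      then have "sum_list (take k I) \<in> breaks I" using j k by (auto simp: breaks_def)
      then show ?thesis using j k by auto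
    qed (use j k in simp)
  next
    assume "x \<in> insert i ((+) i ` breaks I)"
    then consider "x = i" | j where "x = i + sum_list (take j I)" "1 \<le> j" "j < length I"
      by (auto simp: breaks_def)
    then show "x \<in> breaks (i # I)"
    proof cases
      case 1
      then have "x = sum_list (take 1 (i # I)) \<and> 1 \<le> (1::nat) \<and> 1 < length (i # I)"
        using False by simp
      then show ?thesis unfolding breaks_def by blast
    next
      case 2
      then have "x = sum_list (take (Suc j) (i # I)) \<and> 1 \<le> Suc j \<and> Suc j < length (i # I)" by simp
      then show ?thesis unfolding breaks_def by blast
    qed
  qed
  then show ?thesis using False by auto
qed (auto simp: breaks_def)

lemma breaks_snoc: "breaks (I @ [x]) = (if I = [] then {} else insert (sum_list I) (breaks I))"
  by (induction I) (auto simp: breaks_Cons)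

lemma breaks_subset: "I \<in> compositions n \<Longrightarrow> breaks I \<subseteq> {1..<n}"
proof (induction I arbitrary: n)
  case (Cons i I)
  have "0 < sum_list I" if "I \<noteq> []"
    using that Cons.prems sum_list_eq_0_composition [of I]
    by (simp add: compositions_iff del: sum_list_eq_0_iff)
  moreover have "breaks I \<subseteq> {1..<sum_list I}" "0 < i" "n = i + sum_list I"
    using Cons.IH [of "sum_list I"] Cons.prems by (auto simp: compositions_iff)
  ultimately show ?case by (auto simp: breaks_Cons simp del: sum_list_eq_0_iff)
qed (auto simp: breaks_def)

lemma breaks_inject:
  "I \<in> compositions n \<Longrightarrow> J \<in> compositions n \<Longrightarrow> breaks I = breaks J \<Longrightarrow> I = J"
proof (induction I arbitrary: J n)
  case Nil
  then show ?case by (cases J) (auto simp: compositions_iff)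
next
  case (Cons i I)
  then obtain j J' where J: "J = j # J'" by (cases J) (auto simp: compositions_iff)
  show ?case
  proof (cases "I = []")
    case True
    with Cons.prems J have "J' = []" by (simp add: breaks_Cons split: if_splits)
    with True Cons.prems J show ?thesis by (simp add: compositions_iff)
  next
    case False
    with Cons.prems J have ne: "J' \<noteq> []" by (auto simp: breaks_Cons split: if_splits)
    with False Cons.prems J have eq: "insert i ((+) i ` breaks I) = insert j ((+) j ` breaks J')"
      by (simp add: breaks_Cons)
    then have "i \<in> insert j ((+) j ` breaks J')" "j \<in> insert i ((+) i ` breaks I)" by blast+
    then have ij: "i = j" by auto
    have comps: "I \<in> compositions (n - i)" "J' \<in> compositions (n - i)"
      using Cons.prems J ij by (auto simp: compositions_iff)
    have "0 \<notin> breaks I" "0 \<notin> breaks J'"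
      using breaks_subset [OF comps(1)] breaks_subset [OF comps(2)] by auto
    then have "i \<notin> (+) i ` breaks I" "i \<notin> (+) i ` breaks J'" by auto
    then have "(+) i ` breaks I = (+) i ` breaks J'"
      using eq ij insert_ident [of i "(+) i ` breaks I" "(+) i ` breaks J'"] by simp
    then have "breaks I = breaks J'" by (simp add: inj_image_eq_iff)
    then show ?thesis using Cons.IH [OF comps] ij J by simp
  qed
qed

text \<open>Induction on \<open>n\<close>: position \<open>n\<close> becomes a division by appending
  a new part 1, and is skipped by enlarging the last part.\<close>

lemma ex_composition_breaks: "\<exists>I\<in>compositions n. breaks I = {r. 1 \<le> r \<and> r < n \<and> P r}"
proof (induction n)
  case 0
  show ?case by (rule bexI [of _ "[]"]) (auto simp: breaks_def compositions_iff)
next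
  case (Suc n)
  then obtain I where I: "I \<in> compositions n" "breaks I = {r. 1 \<le> r \<and> r < n \<and> P r}" by blast
  show ?case
  proof (cases "I = []")
    case True
    then have "n = 0" using I(1) by (simp add: compositions_iff)
    then show ?thesis
      by (intro bexI [of _ "[1]"]) (auto simp: compositions_iff breaks_Cons)
  next
    case False
    then obtain A x where A: "I = A @ [x]" using rev_exhaust by blast
    then have n: "0 < n" using I by (auto simp: compositions_iff)
    show ?thesis
    proof (cases "P n")
      case True
      have "breaks (I @ [1]) = insert n (breaks I)"
        using I(1) False by (simp add: breaks_snoc compositions_iff)
      also have "\<dots> = {r. 1 \<le> r \<and> r < Suc n \<and> P r}"
        unfolding I(2) using True n by (auto simp: less_Suc_eq)
      finally show ?thesis
        using I(1) by (intro bexI [of _ "I @ [1]"]) (simp_all add: compositions_iff)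
    next
      case False
      have "breaks (A @ [Suc x]) = breaks I" by (simp add: A breaks_snoc)
      also have "\<dots> = {r. 1 \<le> r \<and> r < Suc n \<and> P r}"
        unfolding I(2) using False by (auto simp: less_Suc_eq)
      finally show ?thesis
        using I(1) A by (intro bexI [of _ "A @ [Suc x]"]) (simp_all add: compositions_iff)
    qed
  qed
qed

text \<open>Compositions correspond bijectively to their sets of breaks, so exactly one has the
  descent set of \<open>w\<close>; this gives the \<open>THE\<close> in the definition its
  meaning.\<close>

lemma descent_composition_in_compositions: "descent_composition w \<in> compositions (length w)"
proof -
  define P where "P r \<longleftrightarrow> w ! (r - 1) > w ! r" for r
  define Q where "Q I \<longleftrightarrow> (\<forall>r. 1 \<le> r \<and> r < length w \<longrightarrow>
      (w ! (r - 1) > w ! r \<longleftrightarrow> (\<exists>j. 1 \<le> j \<and> j < length I \<and> r = sum_list (take j I))))" for I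
  have iff: "Q I \<longleftrightarrow> breaks I = {r. 1 \<le> r \<and> r < length w \<and> P r}"
    if "I \<in> compositions (length w)" for I
  proof -
    have "Q I \<longleftrightarrow> (\<forall>r. 1 \<le> r \<and> r < length w \<longrightarrow> (P r \<longleftrightarrow> r \<in> breaks I))"
      by (auto simp: Q_def P_def breaks_def)
    then show ?thesis using breaks_subset [OF that] by (auto simp: set_eq_iff)
  qed
  obtain I where I: "I \<in> compositions (length w)" "breaks I = {r. 1 \<le> r \<and> r < length w \<and> P r}"
    using ex_composition_breaks by blast
  have "\<exists>!I. I \<in> compositions (length w) \<and> Q I"
  proof (rule ex1I [of _ I])
    show "I \<in> compositions (length w) \<and> Q I" using I iff by simp
    show "J = I" if "J \<in> compositions (length w) \<and> Q J" for J
      using that I iff [of J] breaks_inject [of J "length w" I] by simp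
  qed
  then show ?thesis
    unfolding descent_composition_def Q_def by (rule theI' [THEN conjunct1])
qed

lemma Des_in_compositions: "Des n \<sigma> \<in> compositions n"
  unfolding Des_def using descent_composition_in_compositions [of "map \<sigma> [1..<Suc n]"]
  by (simp only: length_map length_upt diff_Suc_1)

section \<open>Rearrangements and coefficients of the idempotents\<close>

lemma rearrangement_composition:
  "I \<in> compositions n \<Longrightarrow> mset I' = mset I \<Longrightarrow> I' \<in> compositions n"
  by (simp add: compositions_def flip: set_mset_mset sum_mset_sum_list)

lemma rearrangements_eq:
  assumes "I \<in> compositions n"
  shows "{I'. I' \<in> all_compositions \<and> mset I' = mset I} = {I'. mset I' = mset I}"
    and "{I'. I' \<in> compositions n \<and> mset I' = mset I} = {I'. mset I' = mset I}"
  using rearrangement_composition [OF assms] by (auto simp: compositions_iff)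

lemma eigen_fI_eq_sum_split_weight:
  assumes I: "I \<in> compositions n" and J: "J \<in> compositions n"
  shows "eigen_fI I J = 1 / fact (length I) *
    (\<Sum>I' | mset I' = mset I. \<Sum>K | refines K J. split_weight I' K)"
  unfolding eigen_fI_def rearrangements_eq [OF I]
proof (rule arg_cong [where f = "(*) _"], rule sum.cong [OF refl])
  fix I' assume "I' \<in> {I'. mset I' = mset I}"
  then show "(\<Prod>r<length I'. eigen_f (decomposition I' J ! r)) = (\<Sum>K | refines K J. split_weight I' K)"
    using rearrangement_composition [OF I, of I'] J
    by (simp add: sum_split_weight_refinements_eigen compositions_iff)
qed

text \<open>Piece \<open>r\<close> of the decomposition has sum \<open>I' ! r\<close>, so the
  factors 1/|J_r| multiply to the reciprocal of the product of the parts, which is the same for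
  every rearrangement.\<close>

lemma eigen_fI_alt:
  assumes I: "I \<in> compositions n" and J: "J \<in> compositions n"
  shows "eigen_fI I J = 1 / (fact (length I) * of_nat (prod_list I)) *
              (\<Sum>I' | I' \<in> all_compositions \<and> mset I' = mset I.
                 \<Prod>r<length I'. (-1) ^ (length (decomposition I' J ! r) - 1) /
                    of_nat ((sum_list (decomposition I' J ! r) - 1)
                              choose (length (decomposition I' J ! r) - 1)))"
proof -
  have "(\<Prod>r<length I'. eigen_f (decomposition I' J ! r)) = 1 / of_nat (prod_list I) *
      (\<Prod>r<length I'. (-1) ^ (length (decomposition I' J ! r) - 1) /
                    of_nat ((sum_list (decomposition I' J ! r) - 1)
                              choose (length (decomposition I' J ! r) - 1)))"
    if "mset I' = mset I" for I'
  proof -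
    have I': "I' \<in> compositions n" using rearrangement_composition [OF I that] .
    then have "map sum_list (decomposition I' J) = I'"
      using J by (simp add: decomposition_eq_cut_at map_sum_list_cut_at compositions_iff)
    then have "sum_list (decomposition I' J ! r) = I' ! r" if "r < length I'" for r
      using that by (metis length_map nth_map)
    then have "(\<Prod>r<length I'. 1 / of_nat (sum_list (decomposition I' J ! r)) :: rat)
        = (\<Prod>r<length I'. 1 / of_nat (I' ! r))"
      by (intro prod.cong) auto
    also have "\<dots> = 1 / of_nat (prod_list I')"
      by (simp add: prod_list_eq_prod_nth prod_dividef)
    also have "prod_list I' = prod_list I"
      using that by (metis prod_mset_prod_list)
    finally show ?thesis
      by (simp only: eigen_f_def prod.distrib)
  qed
  then show ?thesis
    unfolding eigen_fI_def rearrangements_eq [OF I] by (simp add: sum_distrib_left mult.assoc)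
qed

lemma lookup_scale: "Poly_Mapping.lookup (scale c x) \<sigma> = c * Poly_Mapping.lookup x \<sigma>"
  by (simp add: scale_def map.rep_eq when_def)

lemma lookup_GR_B:
  "Poly_Mapping.lookup (GR_B n q) \<tau> = (if \<tau> permutes {1..n} \<and> refines q (Des n \<tau>) then 1 else 0)"
proof -
  have "finite {\<sigma>. \<sigma> permutes {1..n} \<and> refines q (Des n \<sigma>)}"
    by (rule finite_subset [OF _ finite_permutations [of "{1..n}"]]) auto
  then show ?thesis
    by (simp add: GR_B_def lookup_sum lookup_single when_def sum.delta')
qed

text \<open>The coefficient of B_q in I_p is \<open>split_weight p q\<close>, and
  \<open>\<tau>\<close> occurs in B_q exactly when \<open>q\<close> refines its descent
  composition.\<close>

lemma lookup_GR_I: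
  assumes p: "p \<in> compositions n" and \<tau>: "\<tau> permutes {1..n}"
  shows "Poly_Mapping.lookup (GR_I n p) \<tau> = (\<Sum>K | refines K (Des n \<tau>). split_weight p K)"
proof -
  have sp: "(\<Prod>r<length p. (-1) ^ (length (decomposition p q ! r) - 1)
          / of_nat (length (decomposition p q ! r))) = (split_weight p q :: rat)"
    if "refines q p" for q
  proof -
    from that have q: "q \<in> compositions n"
      using refines_compositions p by (auto simp: compositions_iff)
    then have "split_weight p q = prod_list (map log_weight (decomposition p q) :: rat list)"
      using p that by (simp add: split_weight_eq decomposition_eq_cut_at compositions_iff)
    also have "length (decomposition p q) = length p"
      using q p by (simp add: decomposition_eq_cut_at compositions_iff)
    ultimately show ?thesis
      by (simp add: prod_list_eq_prod_nth log_weight_def)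
  qed
  have "Poly_Mapping.lookup (GR_I n p) \<tau>
      = (\<Sum>q | refines q p. if refines q (Des n \<tau>) then split_weight p q else 0)"
    unfolding GR_I_def lookup_sum lookup_scale lookup_GR_B
    by (rule sum.cong [OF refl]) (simp only: mem_Collect_eq sp \<tau>, simp)
  also have "\<dots> = (\<Sum>q | refines q p \<and> refines q (Des n \<tau>). split_weight p q)"
    by (subst sum.inter_filter [symmetric]) (auto simp: finite_refinements)
  also have "\<dots> = (\<Sum>q | refines q (Des n \<tau>). split_weight p q)"
  proof (rule sum.mono_neutral_left)
    show "\<forall>q\<in>{q. refines q (Des n \<tau>)} - {q. refines q p \<and> refines q (Des n \<tau>)}. split_weight p q = (0::rat)"
    proof safe
      fix q assume q: "refines q (Des n \<tau>)" "split_weight p q \<noteq> (0::rat)" 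
      then have "q \<in> compositions n"
        using refines_compositions Des_in_compositions [of n \<tau>] by (auto simp: compositions_iff)
      then show "refines q p"
        using q p split_weight_eq [of q p, where 'a = rat] by (auto simp: compositions_iff split: if_splits)
    qed
  qed (auto simp: finite_refinements)
  finally show ?thesis .
qed

lemma lookup_GR_I_outside:
  "\<not> \<tau> permutes {1..n} \<Longrightarrow> Poly_Mapping.lookup (GR_I n p) \<tau> = 0"
  by (simp add: GR_I_def lookup_sum lookup_scale lookup_GR_B)

text \<open>Coefficient by coefficient, both sides average over the rearrangements of
  \<open>I\<close> the values of the attached functionals at F of the descent composition.\<close>

lemma GR_E_eq:
  assumes I: "I \<in> compositions n"
  shows "GR_E n I = (\<Sum>\<sigma> | \<sigma> permutes {1..n}. Poly_Mapping.single \<sigma> (eigen_fI I (Des n \<sigma>)))"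
proof (rule poly_mapping_eqI)
  fix \<tau>
  have "Poly_Mapping.lookup (GR_E n I) \<tau> = (if \<tau> permutes {1..n} then eigen_fI I (Des n \<tau>) else 0)"
  proof (cases "\<tau> permutes {1..n}")
    case True
    have "Poly_Mapping.lookup (GR_E n I) \<tau> = 1 / fact (length I) *
        (\<Sum>I' | mset I' = mset I. Poly_Mapping.lookup (GR_I n I') \<tau>)"
      by (simp only: GR_E_def rearrangements_eq [OF I] lookup_scale lookup_sum)
    also have "\<dots> = eigen_fI I (Des n \<tau>)"
      unfolding eigen_fI_eq_sum_split_weight [OF I Des_in_compositions]
      using rearrangement_composition [OF I] True
      by (intro arg_cong [where f = "(*) _"] sum.cong) (auto simp: lookup_GR_I)
    finally show ?thesis using True by simp
  qed (simp add: GR_E_def lookup_scale lookup_sum lookup_GR_I_outside)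
  then show "Poly_Mapping.lookup (GR_E n I) \<tau> = Poly_Mapping.lookup
      (\<Sum>\<sigma> | \<sigma> permutes {1..n}. Poly_Mapping.single \<sigma> (eigen_fI I (Des n \<sigma>))) \<tau>"
    by (simp add: lookup_sum lookup_single when_def finite_permutations sum.delta')
qed

section \<open>The Hopf-power matrix on quasisymmetric functions\<close>

text \<open>The iterated coproducts of F_J have only coefficients 0 and 1 on the basis tensors, so
  sets of tuples describe them completely.\<close>

definition indicator_tensor :: "nat list list set \<Rightarrow> tensor" where
  "indicator_tensor X = (\<Sum>t\<in>X. Poly_Mapping.single t 1)"

lemma lookup_indicator_tensor:
  "finite X \<Longrightarrow> Poly_Mapping.lookup (indicator_tensor X) t = (if t \<in> X then 1 else 0)"
  by (simp add: indicator_tensor_def lookup_sum lookup_single when_def sum.delta')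

lemma keys_indicator_tensor: "finite X \<Longrightarrow> Poly_Mapping.keys (indicator_tensor X) = X"
  by (auto simp: in_keys_iff lookup_indicator_tensor split: if_splits)

lemma tensor_of_qsym_F:
  assumes J: "J \<in> all_compositions"
  shows "tensor_of_QSym (qsym_F J) = indicator_tensor ((\<lambda>K. [K]) ` {K. refines K J})"
proof -
  let ?B = "qsym_M ` all_compositions"
  define c where "c I = representation ?B (qsym_F J) (qsym_M I)" for I
  have c: "c I = (if refines I J then 1 else 0)" if I: "I \<in> all_compositions" for I
  proof -
    have "representation ?B (qsym_F J) = (\<lambda>b. \<Sum>K | refines K J. representation ?B (qsym_M K) b)"
      unfolding qsym_F_def
      by (rule real_vector.representation_sum [OF independent_qsym_M])
         (auto intro: real_vector.span_base simp: refines_def)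
    then have "c I = (\<Sum>K | refines K J. representation ?B (qsym_M K) (qsym_M I))"
      by (simp add: c_def)
    also have "\<dots> = (\<Sum>K | refines K J. if K = I then 1 else 0)"
    proof (rule sum.cong [OF refl])
      fix K assume "K \<in> {K. refines K J}"
      then have "K \<in> all_compositions" by (simp add: refines_def)
      then show "representation ?B (qsym_M K) (qsym_M I) = (if K = I then 1 else 0)"
        using I inj_on_qsym_M
        by (subst real_vector.representation_basis [OF independent_qsym_M]) (auto simp: inj_on_eq_iff)
    qed
    also have "\<dots> = (if refines I J then 1 else 0)"
      by (simp add: finite_refinements sum.delta)
    finally show ?thesis .
  qed
  have "{I. I \<in> all_compositions \<and> c I \<noteq> 0} = {K. refines K J}"
    using c by (auto simp: refines_def split: if_splits)
  then have "tensor_of_QSym (qsym_F J) = (\<Sum>K | refines K J. Poly_Mapping.single [K] (c K))"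
    by (simp add: tensor_of_QSym_def c_def [symmetric] Let_def)
  also have "\<dots> = (\<Sum>K | refines K J. Poly_Mapping.single [K] 1)"
    using c by (intro sum.cong) (auto simp: refines_def)
  finally show ?thesis
    by (simp add: indicator_tensor_def sum.reindex inj_on_def)
qed

definition refinement_cuts :: "nat \<Rightarrow> nat list \<Rightarrow> nat list list set" where
  "refinement_cuts a J = {t. length t = a \<and> refines (concat t) J}"

lemma refinement_cuts_eq: "refinement_cuts a J = (\<Union>K\<in>{K. refines K J}. cuts a K)"
  by (auto simp: refinement_cuts_def cuts_def)

lemma finite_refinement_cuts: "finite (refinement_cuts a J)"
  by (simp add: refinement_cuts_eq finite_refinements finite_cuts)

lemma sum_refinement_cuts:
  "(\<Sum>t\<in>refinement_cuts a J. g t) = (\<Sum>K | refines K J. \<Sum>t\<in>cuts a K. g t)"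
  unfolding refinement_cuts_eq
  by (rule sum.UNION_disjoint) (auto simp: finite_refinements finite_cuts, auto simp: cuts_def)

text \<open>Cutting the last of \<open>a\<close> pieces once more produces every tuple of
  \<open>a + 1\<close> pieces exactly once.\<close>

lemma coproduct_last_indicator_tensor:
  assumes "1 \<le> a"
  shows "coproduct_last (indicator_tensor (refinement_cuts a J))
    = indicator_tensor (refinement_cuts (Suc a) J)"
proof -
  have last: "t = butlast t @ [last t]" "concat t = concat (butlast t) @ last t"
    if "length t = Suc m" for t :: "nat list list" and m
    using that by (cases t rule: rev_cases; simp)+
  have "coproduct_last (indicator_tensor (refinement_cuts a J)) =
      (\<Sum>(t, j)\<in>Sigma (refinement_cuts a J) (\<lambda>t. {..length (last t)}).
        Poly_Mapping.single (butlast t @ [take j (last t), drop j (last t)]) 1)"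
    by (simp add: coproduct_last_def keys_indicator_tensor lookup_indicator_tensor
        finite_refinement_cuts sum.Sigma)
  also have "\<dots> = (\<Sum>u\<in>refinement_cuts (Suc a) J. Poly_Mapping.single u 1)"
  \<comment> \<open>The inverse map glues the last two pieces and remembers the length of the first
    of them.\<close>
  proof (rule sum.reindex_bij_witness
      [where j = "\<lambda>(t, j). butlast t @ [take j (last t), drop j (last t)]"
         and i = "\<lambda>u. (butlast (butlast u) @ [last (butlast u) @ last u], length (last (butlast u)))"])
    fix x assume x: "x \<in> Sigma (refinement_cuts a J) (\<lambda>t. {..length (last t)})"
    obtain t j where tj: "x = (t, j)" by (cases x)
    with x assms obtain A y where "t = A @ [y]" "j \<le> length y" "length A = a - 1" "refines (concat A @ y) J"
      by (cases t rule: rev_cases) (auto simp: refinement_cuts_def)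
    with tj assms show
      "(case case x of (t, j) \<Rightarrow> butlast t @ [take j (last t), drop j (last t)] of
         u \<Rightarrow> (butlast (butlast u) @ [last (butlast u) @ last u], length (last (butlast u)))) = x"
      "(case x of (t, j) \<Rightarrow> butlast t @ [take j (last t), drop j (last t)]) \<in> refinement_cuts (Suc a) J"
      by (auto simp: refinement_cuts_def butlast_append)
  next
    fix u assume "u \<in> refinement_cuts (Suc a) J"
    then have u: "length u = Suc a" "refines (concat u) J" by (auto simp: refinement_cuts_def)
    then obtain A z where A: "u = A @ [z]" "length A = a" by (cases u rule: rev_cases) auto
    then obtain B y where "A = B @ [y]" using assms by (cases A rule: rev_cases) auto
    with A u assms show
      "(case (butlast (butlast u) @ [last (butlast u) @ last u], length (last (butlast u))) of
         (t, j) \<Rightarrow> butlast t @ [take j (last t), drop j (last t)]) = u"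
      "(butlast (butlast u) @ [last (butlast u) @ last u], length (last (butlast u)))
         \<in> Sigma (refinement_cuts a J) (\<lambda>t. {..length (last t)})"
      by (auto simp: refinement_cuts_def butlast_append)
  qed auto
  finally show ?thesis by (simp add: indicator_tensor_def)
qed

lemma iterated_coproduct_qsym_F:
  assumes J: "J \<in> all_compositions" and "1 \<le> a"
  shows "iterated_coproduct a (qsym_F J) = indicator_tensor (refinement_cuts a J)"
proof -
  have one: "(\<lambda>K. [K]) ` {K. refines K J} = refinement_cuts 1 J"
    by (auto simp: refinement_cuts_def length_Suc_conv)
  have "(coproduct_last ^^ m) (indicator_tensor (refinement_cuts 1 J))
      = indicator_tensor (refinement_cuts (Suc m) J)" for m
    by (induction m) (simp_all add: coproduct_last_indicator_tensor)
  from this [of "a - 1"] show ?thesis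
    using assms by (simp add: iterated_coproduct_def tensor_of_qsym_F one)
qed

lemma hopf_power_qsym_F:
  assumes "J \<in> all_compositions" "1 \<le> a"
  shows "hopf_power a (qsym_F J) = (\<Sum>t\<in>refinement_cuts a J. prod_list (map qsym_M t))"
  unfolding hopf_power_def iterated_product_def iterated_coproduct_qsym_F [OF assms]
  by (simp add: keys_indicator_tensor lookup_indicator_tensor finite_refinement_cuts)

section \<open>Degree and relabelling of monomials\<close>

definition monomial_degree :: "(nat \<Rightarrow>\<^sub>0 nat) \<Rightarrow> nat" where
  "monomial_degree e = (\<Sum>x\<in>Poly_Mapping.keys e. Poly_Mapping.lookup e x)"

lemma monomial_degree_superset:
  "finite X \<Longrightarrow> Poly_Mapping.keys e \<subseteq> X \<Longrightarrow> monomial_degree e = (\<Sum>x\<in>X. Poly_Mapping.lookup e x)"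
  unfolding monomial_degree_def by (rule sum.mono_neutral_left) (auto simp: in_keys_iff)

lemma monomial_degree_add: "monomial_degree (p + q) = monomial_degree p + monomial_degree q"
proof -
  let ?X = "Poly_Mapping.keys p \<union> Poly_Mapping.keys q"
  have "Poly_Mapping.keys (p + q) \<subseteq> ?X" by (rule keys_add)
  then show ?thesis
    by (simp add: monomial_degree_superset [of ?X] lookup_add sum.distrib)
qed

lemma monomial_degree_single [simp]: "monomial_degree (Poly_Mapping.single x c) = c"
  by (simp add: monomial_degree_def)

lemma monomial_degree_0 [simp]: "monomial_degree 0 = 0"
  by (simp add: monomial_degree_def)

lemma monomial_degree_sum: "monomial_degree (\<Sum>k\<in>A. f k) = (\<Sum>k\<in>A. monomial_degree (f k))"
  by (induction A rule: infinite_finite_induct) (simp_all add: monomial_degree_add)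

text \<open>The pushforward of exponents along \<open>h\<close>; for injective \<open>h\<close> it
  inverts \<open>Poly_Mapping.map_key h\<close> on monomials supported in the range of
  \<open>h\<close>.\<close>

definition push :: "(nat \<Rightarrow> nat) \<Rightarrow> (nat \<Rightarrow>\<^sub>0 nat) \<Rightarrow> (nat \<Rightarrow>\<^sub>0 nat)" where
  "push h e = (\<Sum>x\<in>Poly_Mapping.keys e. Poly_Mapping.single (h x) (Poly_Mapping.lookup e x))"

lemma lookup_push: "inj h \<Longrightarrow> Poly_Mapping.lookup (push h e) (h x) = Poly_Mapping.lookup e x"
  by (simp add: push_def lookup_sum lookup_single when_def inj_eq sum.delta in_keys_iff)

lemma lookup_push_outside: "y \<notin> range h \<Longrightarrow> Poly_Mapping.lookup (push h e) y = 0"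
  by (auto simp: push_def lookup_sum lookup_single when_def intro!: sum.neutral)

lemma keys_push: "Poly_Mapping.keys (push h e) \<subseteq> range h"
  using lookup_push_outside [of _ h e] by (intro subsetI) (metis in_keys_iff)

lemma push_unique:
  assumes "inj h" "Poly_Mapping.keys p \<subseteq> range h"
    "\<And>x. Poly_Mapping.lookup p (h x) = Poly_Mapping.lookup e x"
  shows "p = push h e"
proof (rule poly_mapping_eqI)
  fix y
  show "Poly_Mapping.lookup p y = Poly_Mapping.lookup (push h e) y"
  proof (cases "y \<in> range h")
    case False
    then have "y \<notin> Poly_Mapping.keys p" using assms(2) by blast
    then show ?thesis using False by (simp add: lookup_push_outside in_keys_iff)
  qed (use assms in \<open>auto simp: lookup_push\<close>)
qed

lemma push_eq_iff: "inj h \<Longrightarrow> push h p = push h q \<longleftrightarrow> p = q"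
  by (metis lookup_push poly_mapping_eqI)

lemma push_add:
  assumes "inj h"
  shows "push h (p + q) = push h p + push h q"
proof (rule push_unique [symmetric, OF assms])
  show "Poly_Mapping.keys (push h p + push h q) \<subseteq> range h"
    using keys_add [of "push h p" "push h q"] keys_push [of h p] keys_push [of h q] by blast
qed (simp add: lookup_push lookup_add assms)

lemma push_single: "inj h \<Longrightarrow> push h (Poly_Mapping.single x c) = Poly_Mapping.single (h x) c"
  by (simp add: push_def)

lemma push_0: "push h 0 = 0"
  by (simp add: push_def)

lemma push_sum: "inj h \<Longrightarrow> push h (\<Sum>k\<in>A. f k) = (\<Sum>k\<in>A. push h (f k))"
  by (induction A rule: infinite_finite_induct) (simp_all add: push_add push_0)

lemma push_surj:
  assumes "inj h" "Poly_Mapping.keys p \<subseteq> range h"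
  obtains e where "p = push h e"
proof -
  have "p = push h (Poly_Mapping.map_key h p)"
    using assms by (intro push_unique) (simp_all add: map_key.rep_eq)
  then show ?thesis by (rule that)
qed

text \<open>Exponents are natural numbers, so factors involve only variables of the product, hence
  only those in the range of \<open>h\<close>.\<close>

lemma splits_push:
  assumes "inj h"
  shows "splits (push h e) = (\<lambda>(p, q). (push h p, push h q)) ` splits e"
proof (intro equalityI subsetI)
  fix x assume "x \<in> splits (push h e)"
  then obtain p q where pq: "x = (p, q)" "p + q = push h e" by (auto simp: splits_def)
  have "Poly_Mapping.keys p \<subseteq> Poly_Mapping.keys (p + q)" "Poly_Mapping.keys q \<subseteq> Poly_Mapping.keys (p + q)"
    by (auto simp: in_keys_iff lookup_add)
  then have "Poly_Mapping.keys p \<subseteq> range h" "Poly_Mapping.keys q \<subseteq> range h"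
    using keys_push [of h e] pq by auto
  then obtain p' q' where "p = push h p'" "q = push h q'"
    using push_surj [OF assms] by metis
  moreover from this pq have "p' + q' = e"
    by (metis push_add push_eq_iff assms)
  ultimately show "x \<in> (\<lambda>(p, q). (push h p, push h q)) ` splits e"
    using pq by (auto simp: splits_def)
qed (auto simp: splits_def push_add assms)

text \<open>Homogeneity of degree \<open>n\<close> and invariance under increasing relabelling. This
  intrinsic property is closed under products, which replaces an explicit quasi-shuffle rule when
  products of M are expanded in M.\<close>

definition quasisymmetric :: "nat \<Rightarrow> power_series \<Rightarrow> bool" where
  "quasisymmetric n f \<longleftrightarrow>
     (\<forall>e. coefficient f e \<noteq> 0 \<longrightarrow> monomial_degree e = n) \<and>
     (\<forall>h e. strict_mono h \<longrightarrow> coefficient f (push h e) = coefficient f e)"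

lemma quasisymmetric_1: "quasisymmetric 0 1"
proof -
  have "push h e = 0 \<longleftrightarrow> e = 0" if "strict_mono h" for h e
    using push_eq_iff [of h e 0] that by (simp add: push_0 strict_mono_imp_inj_on)
  then show ?thesis by (simp add: quasisymmetric_def one_power_series_def)
qed

lemma quasisymmetric_mult:
  assumes "quasisymmetric m f" "quasisymmetric n g"
  shows "quasisymmetric (m + n) (f * g)"
  unfolding quasisymmetric_def
proof (intro conjI allI impI)
  fix e assume "coefficient (f * g) e \<noteq> 0"
  then have "\<exists>(p, q)\<in>splits e. coefficient f p * coefficient g q \<noteq> 0"
    unfolding times_power_series_def coefficient_Power_Series case_prod_unfold
    by (rule sum.not_neutral_contains_not_neutral) blast
  then show "monomial_degree e = m + n"
    using assms by (auto simp: quasisymmetric_def splits_def monomial_degree_add)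
next
  fix h :: "nat \<Rightarrow> nat" and e assume h: "strict_mono h"
  then have inj: "inj h" by (rule strict_mono_imp_inj_on)
  have "inj_on (\<lambda>(p, q). (push h p, push h q)) (splits e)"
    by (auto simp: inj_on_def push_eq_iff [OF inj])
  then show "coefficient (f * g) (push h e) = coefficient (f * g) e"
    using assms h
    by (simp add: times_power_series_def splits_push [OF inj] sum.reindex)
       (simp add: case_prod_unfold quasisymmetric_def)
qed

text \<open>The index lists that represent \<open>push h e\<close> are exactly the images under
  \<open>h\<close> of those that represent \<open>e\<close>.\<close>

lemma quasisymmetric_qsym_M:
  assumes A: "A \<in> all_compositions"
  shows "quasisymmetric (sum_list A) (qsym_M A)"
  unfolding quasisymmetric_def
proof (intro conjI allI impI)
  fix e assume "coefficient (qsym_M A) e \<noteq> 0"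
  then have "{js. length js = length A \<and> sorted_wrt (<) js \<and>
     (\<Sum>k<length A. Poly_Mapping.single (js ! k) (A ! k)) = e} \<noteq> {}"
    unfolding qsym_M_def by (metis card.empty coefficient_Power_Series of_nat_0)
  then obtain js where "(\<Sum>k<length A. Poly_Mapping.single (js ! k) (A ! k)) = e" by blast
  then show "monomial_degree e = sum_list A"
    by (auto simp: monomial_degree_sum sum_list_sum_nth atLeast0LessThan)
next
  fix h :: "nat \<Rightarrow> nat" and e assume h: "strict_mono h"
  then have inj: "inj h" by (rule strict_mono_imp_inj_on)
  define S :: "(nat \<Rightarrow>\<^sub>0 nat) \<Rightarrow> nat list set" where "S e = {js. length js = length A \<and> sorted_wrt (<) js \<and>
     (\<Sum>k<length A. Poly_Mapping.single (js ! k) (A ! k)) = e}" for e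
  have push: "(\<Sum>k<length A. Poly_Mapping.single (map h js ! k) (A ! k))
      = push h (\<Sum>k<length A. Poly_Mapping.single (js ! k) (A ! k))" if "length js = length A" for js
    using that by (simp add: push_sum push_single inj)
  have sorted: "sorted_wrt (<) (map h js) \<longleftrightarrow> sorted_wrt (<) js" for js
    using h by (simp add: sorted_wrt_map strict_mono_less)
  have "S (push h e) = map h ` S e"
  proof (intro equalityI subsetI)
    fix js assume js: "js \<in> S (push h e)"
    \<comment> \<open>A positive part makes its variable occur in the monomial, so the index must
      lie in the range of \<open>h\<close>.\<close>
    have "js ! i \<in> range h" if i: "i < length A" for i
    proof -
      have "0 < A ! i" using A i by (auto simp: all_compositions_def)
      also have "A ! i \<le> (\<Sum>k<length A. if js ! k = js ! i then A ! k else 0)"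
        using member_le_sum [of i "{..<length A}" "\<lambda>k. if js ! k = js ! i then A ! k else 0"] i by simp
      also have "\<dots> = Poly_Mapping.lookup (push h e) (js ! i)"
        using js by (simp add: S_def flip: lookup_single_sum)
      finally show ?thesis using lookup_push_outside [of "js ! i" h e] by (metis less_numeral_extra(3))
    qed
    then have "set js \<subseteq> range h" using js by (auto simp: S_def in_set_conv_nth)
    then have m: "js = map h (map (inv h) js)"
      by (simp add: map_idI subset_iff f_inv_into_f)
    define ks where "ks = map (inv h) js"
    have "js = map h ks" using m by (simp add: ks_def)
    moreover from this js have "ks \<in> S e"
      using push [of ks] by (auto simp: S_def sorted push_eq_iff [OF inj])
    ultimately show "js \<in> map h ` S e" by blast
  qed (auto simp: S_def sorted push_sum push_single inj)
  moreover have "inj_on (map h) (S e)" by (rule inj_on_subset [OF inj_mapI [OF inj]]) simp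
  ultimately have "card (S (push h e)) = card (S e)" by (simp add: card_image)
  then show "coefficient (qsym_M A) (push h e) = coefficient (qsym_M A) e"
    by (simp add: qsym_M_def S_def)
qed

lemma quasisymmetric_prod_qsym_M:
  "concat t \<in> all_compositions \<Longrightarrow> quasisymmetric (sum_list (concat t)) (prod_list (map qsym_M t))"
  by (induction t) (auto simp: quasisymmetric_1 intro!: quasisymmetric_mult quasisymmetric_qsym_M)

lemma monomial_as_push:
  obtains J h where "J \<in> compositions (monomial_degree e)" "strict_mono h"
    "e = push h (\<Sum>k<length J. Poly_Mapping.single k (J ! k))"
proof
  define ks where "ks = sorted_list_of_set (Poly_Mapping.keys e)"
  define J where "J = map (Poly_Mapping.lookup e) ks"
  \<comment> \<open>Beyond the support \<open>h\<close> continues above the maximum, which keeps it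
    strictly increasing; inserting 0 covers the empty support.\<close>
  define h where "h i = (if i < length ks then ks ! i else Suc (Max (insert 0 (set ks))) + i)" for i
  have ks: "set ks = Poly_Mapping.keys e" "distinct ks" "sorted_wrt (<) ks"
    by (simp_all add: ks_def)
  show mono: "strict_mono h"
  proof (rule strict_monoI)
    fix i j :: nat assume "i < j"
    have "ks ! i < Suc (Max (insert 0 (set ks))) + j" if "i < length ks"
    proof -
      have "ks ! i \<le> Max (insert 0 (set ks))" using that by (intro Max_ge) simp_all
      then show ?thesis by linarith
    qed
    then show "h i < h j"
      using \<open>i < j\<close> sorted_wrt_nth_less [OF ks(3) \<open>i < j\<close>] by (auto simp: h_def)
  qed
  have "sum_list J = monomial_degree e"
    using ks by (simp add: J_def monomial_degree_def sum_list_distinct_conv_sum_set)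
  then show "J \<in> compositions (monomial_degree e)"
    using ks by (auto simp: J_def compositions_def in_keys_iff)
  have "push h (\<Sum>k<length J. Poly_Mapping.single k (J ! k))
      = (\<Sum>k<length J. Poly_Mapping.single (h k) (J ! k))"
    using mono by (simp add: push_sum push_single strict_mono_imp_inj_on)
  also have "\<dots> = (\<Sum>k<length ks. Poly_Mapping.single (ks ! k) (Poly_Mapping.lookup e (ks ! k)))"
    by (intro sum.cong) (auto simp: J_def h_def)
  also have "\<dots> = (\<Sum>x\<in>set ks. Poly_Mapping.single x (Poly_Mapping.lookup e x))"
    using ks(2) by (simp add: sum_list_sum_nth atLeast0LessThan flip: sum_list_distinct_conv_sum_set)
  also have "\<dots> = e"
    by (rule poly_mapping_eqI)
       (simp add: ks lookup_sum lookup_single when_def sum.delta in_keys_iff)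
  finally show "e = push h (\<Sum>k<length J. Poly_Mapping.single k (J ! k))" by simp
qed

text \<open>Every monomial is an increasing relabelling of a packed one, with exponents
  \<open>J\<close> on the first variables. Among the M of degree \<open>n\<close>, only M_J is
  nonzero at the packed monomial of \<open>J\<close>.\<close>

lemma quasisymmetric_expansion:
  assumes f: "quasisymmetric n f"
  shows "f = (\<Sum>J\<in>compositions n.
    coefficient f (\<Sum>k<length J. Poly_Mapping.single k (J ! k)) *\<^sub>R qsym_M J)"
  unfolding power_series_eq_iff coefficient_scaled_sum
proof
  fix e
  obtain K h where K: "K \<in> compositions (monomial_degree e)" and h: "strict_mono h"
    and e: "e = push h (\<Sum>k<length K. Poly_Mapping.single k (K ! k))"
    by (rule monomial_as_push)
  let ?m = "\<lambda>J. \<Sum>k<length J. Poly_Mapping.single k (J ! k)"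
  have "coefficient (qsym_M J) e = (if J = K then 1 else 0)" if "J \<in> compositions n" for J
    using quasisymmetric_qsym_M [of J] h that K unfolding e
    by (simp add: quasisymmetric_def coefficient_qsym_M_leading compositions_iff)
  then have "(\<Sum>J\<in>compositions n. coefficient f (?m J) * coefficient (qsym_M J) e)
      = (\<Sum>J\<in>compositions n. if J = K then coefficient f (?m J) else 0)"
    by (intro sum.cong) auto
  also have "\<dots> = (if monomial_degree e = n then coefficient f (?m K) else 0)"
    using K by (auto simp: finite_compositions compositions_iff)
  also have "coefficient f (?m K) = coefficient f e"
    using f h unfolding e by (simp add: quasisymmetric_def)
  also have "(if monomial_degree e = n then coefficient f e else 0) = coefficient f e"
    using f by (auto simp: quasisymmetric_def)
  finally show "coefficient f e = (\<Sum>J\<in>compositions n. coefficient f (?m J) * coefficient (qsym_M J) e)" ..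
qed

section \<open>The fundamental basis in a fixed degree\<close>

lemma coefficient_qsym_F_leading:
  assumes "J \<in> all_compositions" "K \<in> all_compositions"
  shows "coefficient (qsym_F J) (\<Sum>k<length K. Poly_Mapping.single k (K ! k))
       = (if refines K J then 1 else 0)"
proof -
  have "coefficient (qsym_F J) (\<Sum>k<length K. Poly_Mapping.single k (K ! k))
      = (\<Sum>L | refines L J. if L = K then 1 else 0)"
    unfolding qsym_F_def
    using coefficient_scaled_sum [of "\<lambda>_. 1" qsym_M "{L. refines L J}"] assms
    by (auto simp: coefficient_qsym_M_leading refines_def intro!: sum.cong)
  then show ?thesis by (simp add: finite_refinements)
qed

lemma inj_on_qsym_F: "inj_on qsym_F (compositions n)"
proof (rule inj_onI)
  fix J K assume "J \<in> compositions n" "K \<in> compositions n" "qsym_F J = qsym_F K"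
  then have "refines J K \<longleftrightarrow> refines J J" "refines K J \<longleftrightarrow> refines K K"
    by (metis coefficient_qsym_F_leading compositions_iff zero_neq_one)+
  then show "J = K"
    using \<open>J \<in> _\<close> \<open>K \<in> _\<close> by (auto simp: compositions_iff refines_refl intro: refines_antisym)
qed

text \<open>Triangularity: F_J minus M_J involves only proper refinements of \<open>J\<close>, which
  are longer.\<close>

lemma qsym_M_in_span: "J \<in> compositions n \<Longrightarrow> qsym_M J \<in> span (qsym_F ` compositions n)"
proof (induction "n - length J" arbitrary: J rule: less_induct)
  case less
  have J: "J \<in> all_compositions" "sum_list J = n" using less.prems by (auto simp: compositions_iff)
  have "qsym_F J = qsym_M J + (\<Sum>K\<in>{K. refines K J} - {J}. qsym_M K)"
    unfolding qsym_F_def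
    by (rule sum.remove) (auto simp: finite_refinements refines_refl J)
  moreover have "(\<Sum>K\<in>{K. refines K J} - {J}. qsym_M K) \<in> span (qsym_F ` compositions n)"
  proof (rule span_sum)
    fix K assume K: "K \<in> {K. refines K J} - {J}"
    then have "K \<in> compositions n" using refines_compositions J by auto
    moreover from this have "length K \<le> n"
      using length_le_sum_list by (auto simp: compositions_iff)
    moreover have "length J < length K"
      using K refines_same_length [of K J] by (metis DiffE insertI1 mem_Collect_eq not_le)
    ultimately show "qsym_M K \<in> span (qsym_F ` compositions n)"
      using less.hyps [of K] by simp
  qed
  ultimately show ?case
    using less.prems by (metis add_diff_cancel_right' imageI span_base span_diff)
qed

text \<open>At the packed monomial of \<open>J\<close> only those F_K contribute for which
  \<open>J\<close> refines \<open>K\<close>. Apart from \<open>J\<close> itself these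
  \<open>K\<close> are shorter, so their scalars vanish by induction.\<close>

lemma independent_qsym_F: "independent (qsym_F ` compositions n)"
proof (rule real_vector.independent_if_scalars_zero)
  show "finite (qsym_F ` compositions n)" by (simp add: finite_compositions)
  fix u v assume u: "(\<Sum>x\<in>qsym_F ` compositions n. u x *\<^sub>R x) = 0" and v: "v \<in> qsym_F ` compositions n"
  have "u (qsym_F J) = 0" if "J \<in> compositions n" for J
    using that
  proof (induction "length J" arbitrary: J rule: less_induct)
    case less
    let ?m = "\<Sum>k<length J. Poly_Mapping.single k (J ! k)"
    have "(\<Sum>K\<in>compositions n. u (qsym_F K) *\<^sub>R qsym_F K) = 0"
      using u by (simp add: sum.reindex [OF inj_on_qsym_F])
    then have "0 = coefficient (\<Sum>K\<in>compositions n. u (qsym_F K) *\<^sub>R qsym_F K) ?m"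
      by (simp add: zero_power_series_def)
    also have "\<dots> = (\<Sum>K\<in>compositions n. if K = J then u (qsym_F K) else 0)"
      unfolding coefficient_scaled_sum
    proof (rule sum.cong [OF refl])
      fix K assume K: "K \<in> compositions n"
      have "u (qsym_F K) = 0" if "refines J K" "K \<noteq> J"
        using less.hyps [of K] K that length_refines [of J K] refines_same_length [of J K] by force
      then show "u (qsym_F K) * coefficient (qsym_F K) ?m = (if K = J then u (qsym_F K) else 0)"
        using K less.prems by (auto simp: coefficient_qsym_F_leading compositions_iff refines_refl)
    qed
    also have "\<dots> = u (qsym_F J)"
      using less.prems by (simp add: finite_compositions)
    finally show ?case ..
  qed
  with v show "u v = 0" by blast
qed

text \<open>\<open>representation\<close> is 0 outside the span, so the Hopf power must be shown to
  lie in the span of the F; it does because each product of M is quasisymmetric of degree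
  \<open>n\<close>.\<close>

lemma sum_hopf_power_matrix:
  assumes J: "J \<in> compositions n" and "1 \<le> a"
  shows "(\<Sum>K\<in>compositions n. hopf_power_matrix a n J K *\<^sub>R qsym_F K)
    = (1 / real a ^ n) *\<^sub>R hopf_power a (qsym_F J)"
proof -
  let ?v = "(1 / real a ^ n) *\<^sub>R hopf_power a (qsym_F J)"
  have "prod_list (map qsym_M t) \<in> span (qsym_F ` compositions n)" if "t \<in> refinement_cuts a J" for t
  proof -
    have "refines (concat t) J" using that by (simp add: refinement_cuts_def)
    then have "concat t \<in> compositions n" using refines_compositions J by (auto simp: compositions_iff)
    then have "quasisymmetric n (prod_list (map qsym_M t))"
      using quasisymmetric_prod_qsym_M [of t] by (simp add: compositions_iff)
    from quasisymmetric_expansion [OF this] show ?thesis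
      by (metis (no_types, lifting) qsym_M_in_span span_scale span_sum)
  qed
  then have "?v \<in> span (qsym_F ` compositions n)"
    using J assms by (auto simp: hopf_power_qsym_F compositions_iff intro!: span_scale span_sum)
  then have "(\<Sum>b\<in>qsym_F ` compositions n. representation (qsym_F ` compositions n) ?v b *\<^sub>R b) = ?v"
    by (intro real_vector.sum_representation_eq independent_qsym_F) (simp_all add: finite_compositions)
  then show ?thesis
    by (simp add: sum.reindex [OF inj_on_qsym_F] hopf_power_matrix_def)
qed

section \<open>Substituting a finite alphabet\<close>

text \<open>\<open>substitute bs\<close> replaces the variable with index \<open>i\<close> by the one with index \<open>bs ! i\<close> for
  \<open>i < length bs\<close> and by 0 otherwise, so \<open>bs\<close> is an ordered finite alphabet; the fibres
  \<open>block_monomials\<close> are finite because of the truncation.\<close>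

definition block_exponent :: "nat list \<Rightarrow> (nat \<Rightarrow>\<^sub>0 nat) \<Rightarrow> (nat \<Rightarrow>\<^sub>0 nat)" where
  "block_exponent bs e = (\<Sum>i<length bs. Poly_Mapping.single (bs ! i) (Poly_Mapping.lookup e i))"

definition block_monomials :: "nat list \<Rightarrow> (nat \<Rightarrow>\<^sub>0 nat) \<Rightarrow> (nat \<Rightarrow>\<^sub>0 nat) set" where
  "block_monomials bs d = {e. Poly_Mapping.keys e \<subseteq> {..<length bs} \<and> block_exponent bs e = d}"

definition substitute :: "nat list \<Rightarrow> power_series \<Rightarrow> power_series" where
  "substitute bs f = Power_Series (\<lambda>d. \<Sum>e\<in>block_monomials bs d. coefficient f e)"

definition monomial :: "(nat \<Rightarrow>\<^sub>0 nat) \<Rightarrow> power_series" where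
  "monomial d = Power_Series (\<lambda>m. if m = d then 1 else 0)"

text \<open>Substitution preserves the total degree, which bounds all exponents in a fibre.\<close>

lemma finite_block_monomials: "finite (block_monomials bs d)"
proof -
  have "Poly_Mapping.lookup e i \<le> monomial_degree d" if "e \<in> block_monomials bs d" "i < length bs" for e i
  proof -
    have "monomial_degree d = (\<Sum>i<length bs. Poly_Mapping.lookup e i)"
      using that by (auto simp: block_monomials_def block_exponent_def monomial_degree_sum)
    then show ?thesis using that by (simp add: member_le_sum)
  qed
  then have "Poly_Mapping.lookup ` block_monomials bs d \<subseteq>
      {f. \<forall>x. (x \<in> {..<length bs} \<longrightarrow> f x \<in> {..monomial_degree d}) \<and> (x \<notin> {..<length bs} \<longrightarrow> f x = 0)}"
    unfolding block_monomials_def by (auto simp: in_keys_iff subset_iff)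
  moreover have "finite \<dots>" by (rule finite_set_of_finite_funs) auto
  ultimately have "finite (Poly_Mapping.lookup ` block_monomials bs d)" by (rule finite_subset)
  then show ?thesis by (rule finite_imageD) (auto intro: inj_onI poly_mapping_eqI)
qed

lemma block_exponent_add: "block_exponent bs (p + q) = block_exponent bs p + block_exponent bs q"
  by (simp add: block_exponent_def lookup_add single_add sum.distrib)

lemma block_exponent_sum:
  "block_exponent bs (\<Sum>k\<in>A. f k) = (\<Sum>k\<in>A. block_exponent bs (f k))"
  by (induction A rule: infinite_finite_induct)
     (simp_all add: block_exponent_add, simp_all add: block_exponent_def)

lemma block_exponent_single:
  "i < length bs \<Longrightarrow> block_exponent bs (Poly_Mapping.single i c) = Poly_Mapping.single (bs ! i) c"
proof -
  assume i: "i < length bs"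
  have "block_exponent bs (Poly_Mapping.single i c) =
      (\<Sum>k<length bs. if k = i then Poly_Mapping.single (bs ! i) c else 0)"
    unfolding block_exponent_def by (rule sum.cong) (auto simp: lookup_single when_def)
  then show ?thesis using i by simp
qed

lemma substitute_0 [simp]: "substitute bs 0 = 0"
  by (simp add: substitute_def zero_power_series_def)

lemma substitute_add: "substitute bs (f + g) = substitute bs f + substitute bs g"
  by (simp add: substitute_def plus_power_series_def sum.distrib)

lemma substitute_scaleR: "substitute bs (c *\<^sub>R f) = c *\<^sub>R substitute bs f"
  by (simp add: substitute_def scaleR_power_series_def sum_distrib_left)

lemma substitute_sum: "substitute bs (\<Sum>x\<in>A. f x) = (\<Sum>x\<in>A. substitute bs (f x))"
  by (induction A rule: infinite_finite_induct) (simp_all add: substitute_add)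

text \<open>Both sides sum over pairs \<open>p\<close>, \<open>q\<close> of monomials whose images
  multiply to \<open>d\<close>, grouped on the left by \<open>p + q\<close> and on the right by the
  pair of images.\<close>

lemma substitute_mult: "substitute bs (f * g) = substitute bs f * substitute bs g"
  unfolding power_series_eq_iff
proof
  fix d
  let ?N = "{..<length bs}"
  have keys: "Poly_Mapping.keys (p + q) = Poly_Mapping.keys p \<union> Poly_Mapping.keys q"
    for p q :: "nat \<Rightarrow>\<^sub>0 nat"
    by (auto simp: in_keys_iff lookup_add)
  have "coefficient (substitute bs (f * g)) d
      = (\<Sum>(e, p, q)\<in>Sigma (block_monomials bs d) splits. coefficient f p * coefficient g q)"
    by (simp add: substitute_def times_power_series_def sum.Sigma finite_block_monomials finite_splits)
  also have "\<dots> = (\<Sum>(D, p, q)\<in>Sigma (splits d) (\<lambda>D. block_monomials bs (fst D) \<times> block_monomials bs (snd D)).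
      coefficient f p * coefficient g q)"
    by (rule sum.reindex_bij_witness
        [where i = "\<lambda>(D, p, q). (p + q, p, q)"
          and j = "\<lambda>(e, p, q). ((block_exponent bs p, block_exponent bs q), p, q)"])
       (auto simp: splits_def block_monomials_def keys block_exponent_add,
        (metis lessThan_iff subset_iff)+)
  also have "\<dots> = (\<Sum>D\<in>splits d. \<Sum>(p, q)\<in>block_monomials bs (fst D) \<times> block_monomials bs (snd D).
      coefficient f p * coefficient g q)"
    by (rule sum.Sigma [symmetric]) (auto simp: finite_splits finite_block_monomials)
  also have "\<dots> = coefficient (substitute bs f * substitute bs g) d"
    by (simp add: substitute_def times_power_series_def sum_product sum.cartesian_product case_prod_unfold)
  finally show "coefficient (substitute bs (f * g)) d = coefficient (substitute bs f * substitute bs g) d" .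
qed

lemma substitute_1: "substitute bs 1 = 1"
  unfolding power_series_eq_iff
proof
  fix d
  have "(\<Sum>e\<in>block_monomials bs d. if e = 0 then 1 else 0) = (if 0 \<in> block_monomials bs d then 1 else (0::real))"
    by (simp add: finite_block_monomials)
  also have "0 \<in> block_monomials bs d \<longleftrightarrow> d = 0"
    by (auto simp: block_monomials_def block_exponent_def)
  finally show "coefficient (substitute bs 1) d = coefficient 1 d"
    by (simp add: substitute_def one_power_series_def)
qed

lemma substitute_prod_list: "substitute bs (prod_list fs) = prod_list (map (substitute bs) fs)"
  by (induction fs) (simp_all add: substitute_1 substitute_mult)

lemma monomial_0 [simp]: "monomial 0 = 1"
  by (simp add: monomial_def one_power_series_def)

lemma monomial_add: "monomial (d + e) = monomial d * monomial e"
  unfolding power_series_eq_iff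
proof
  fix m
  have "coefficient (monomial d * monomial e) m = (\<Sum>x\<in>splits m. if x = (d, e) then 1 else 0)"
    unfolding times_power_series_def coefficient_Power_Series
    by (rule sum.cong) (auto simp: monomial_def split: if_splits)
  then show "coefficient (monomial (d + e)) m = coefficient (monomial d * monomial e) m"
    by (auto simp: finite_splits, auto simp: splits_def monomial_def)
qed

lemma monomial_sum: "monomial (\<Sum>k\<in>A. f k) = (\<Prod>k\<in>A. monomial (f k))"
  by (induction A rule: infinite_finite_induct) (simp_all add: monomial_add)

lemma keys_monomial_sum:
  assumes "A \<in> all_compositions" "length js = length A"
  shows "Poly_Mapping.keys (\<Sum>k<length A. Poly_Mapping.single (js ! k) (A ! k)) = set js"
proof (intro equalityI subsetI)
  fix x assume "x \<in> set js"
  then obtain i where i: "i < length A" "x = js ! i" using assms by (auto simp: in_set_conv_nth)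
  have "0 < A ! i" using assms i by (auto simp: all_compositions_def)
  also have "A ! i \<le> (\<Sum>k<length A. if js ! k = js ! i then A ! k else 0)"
    using member_le_sum [of i "{..<length A}" "\<lambda>k. if js ! k = js ! i then A ! k else 0"] i by simp
  finally show "x \<in> Poly_Mapping.keys (\<Sum>k<length A. Poly_Mapping.single (js ! k) (A ! k))"
    unfolding i(2) in_keys_iff lookup_single_sum by (rule gr_implies_not0)
next
  fix x assume "x \<in> Poly_Mapping.keys (\<Sum>k<length A. Poly_Mapping.single (js ! k) (A ! k))"
  then have "(\<Sum>k<length A. if js ! k = x then A ! k else 0) \<noteq> 0"
    by (simp add: in_keys_iff lookup_single_sum)
  then obtain k where "k < length A" "js ! k = x"
    by (rule sum.not_neutral_contains_not_neutral) (auto split: if_splits)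
  then show "x \<in> set js" using assms by auto
qed

section \<open>Evaluation of M at a finite alphabet\<close>

definition increasing_lists :: "nat \<Rightarrow> nat \<Rightarrow> nat list set" where
  "increasing_lists N l = {js. length js = l \<and> sorted_wrt (<) js \<and> set js \<subseteq> {..<N}}"

lemma finite_increasing_lists: "finite (increasing_lists N l)"
  by (rule finite_subset [OF _ finite_lists_length_eq [of "{..<N}" l]])
     (auto simp: increasing_lists_def)

lemma increasing_lists_0: "increasing_lists N 0 = {[]}"
  by (auto simp: increasing_lists_def)

lemma increasing_lists_empty: "increasing_lists 0 (Suc l) = {}"
  by (auto simp: increasing_lists_def)

lemma increasing_lists_Suc:
  "increasing_lists (Suc N) (Suc l)
    = map Suc ` increasing_lists N (Suc l) \<union> (\<lambda>js. 0 # map Suc js) ` increasing_lists N l"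
proof (intro equalityI subsetI)
  fix js assume js: "js \<in> increasing_lists (Suc N) (Suc l)"
  then obtain x xs where xs: "js = x # xs" "length xs = l" by (auto simp: increasing_lists_def length_Suc_conv)
  have pos: "ys = map Suc (map (\<lambda>y. y - 1) ys)" if "\<forall>y\<in>set ys. 0 < y" for ys
    using that by (simp add: map_idI)
  have dec: "map (\<lambda>y. y - 1) ys \<in> increasing_lists N (length ys)"
    if "\<forall>y\<in>set ys. 0 < y" "sorted_wrt (<) ys" "set ys \<subseteq> {..<Suc N}" for ys
  proof -
    from pos [OF that(1)] obtain zs where "ys = map Suc zs" by blast
    with that show ?thesis by (auto simp: increasing_lists_def sorted_wrt_map)
  qed
  show "js \<in> map Suc ` increasing_lists N (Suc l) \<union> (\<lambda>js. 0 # map Suc js) ` increasing_lists N l"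
  proof (cases "x = 0")
    case True
    then have "\<forall>y\<in>set xs. 0 < y" "sorted_wrt (<) xs" "set xs \<subseteq> {..<Suc N}"
      using js xs by (auto simp: increasing_lists_def)
    then show ?thesis using pos [of xs] dec [of xs] xs True by blast
  next
    case False
    then have "\<forall>y\<in>set js. 0 < y" "sorted_wrt (<) js" "set js \<subseteq> {..<Suc N}" "length js = Suc l"
      using js xs by (auto simp: increasing_lists_def)
    then show ?thesis using pos [of js] dec [of js] by (metis UnI1 imageI)
  qed
qed (auto simp: increasing_lists_def sorted_wrt_map)

text \<open>Positions, not letters, have to increase, so repeated letters are allowed. As all parts
  are positive, every entry of \<open>js\<close> occurs in the monomial, and truncation keeps
  exactly the lists with entries below \<open>length bs\<close>.\<close>

lemma substitute_qsym_M:
  assumes J: "J \<in> all_compositions"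
  shows "substitute bs (qsym_M J) = (\<Sum>js\<in>increasing_lists (length bs) (length J).
    monomial (\<Sum>k<length J. Poly_Mapping.single (bs ! (js ! k)) (J ! k)))"
  unfolding power_series_eq_iff
proof
  fix d
  let ?e = "\<lambda>js. \<Sum>k<length J. Poly_Mapping.single (js ! k) (J ! k)"
  let ?S = "\<lambda>e. {js. length js = length J \<and> sorted_wrt (<) js \<and> ?e js = e}"
  let ?I = "increasing_lists (length bs) (length J)"
  have mem: "js ! k < length bs" if "js \<in> ?I" "k < length J" for js k
  proof -
    from that have "set js \<subseteq> {..<length bs}" "js ! k \<in> set js" by (simp_all add: increasing_lists_def)
    then have "js ! k \<in> {..<length bs}" by blast
    then show ?thesis by simp
  qed
  have U: "(\<Union>e\<in>block_monomials bs d. ?S e) = {js\<in>?I. (\<Sum>k<length J. Poly_Mapping.single (bs ! (js ! k)) (J ! k)) = d}"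
  proof -
    have "block_exponent bs (?e js) = (\<Sum>k<length J. Poly_Mapping.single (bs ! (js ! k)) (J ! k))"
      if "js \<in> ?I" for js
      using mem [OF that] by (simp add: block_exponent_sum block_exponent_single)
    moreover have "length js = length J \<Longrightarrow> Poly_Mapping.keys (?e js) = set js" for js
      by (rule keys_monomial_sum [OF J])
    ultimately show ?thesis
      by (auto simp: block_monomials_def) (auto simp: increasing_lists_def)
  qed
  have fin: "finite (?S e)" if "e \<in> block_monomials bs d" for e
    by (rule finite_subset [OF _ finite_increasing_lists [of "length bs" "length J"]])
       (use that U in blast)
  have "coefficient (substitute bs (qsym_M J)) d = real (\<Sum>e\<in>block_monomials bs d. card (?S e))"
    by (simp add: substitute_def qsym_M_def)
  also have "(\<Sum>e\<in>block_monomials bs d. card (?S e)) = card (\<Union>e\<in>block_monomials bs d. ?S e)"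
    by (rule card_UN_disjoint [symmetric]) (auto simp: finite_block_monomials fin)
  also have "real \<dots> = (\<Sum>js\<in>?I. if (\<Sum>k<length J. Poly_Mapping.single (bs ! (js ! k)) (J ! k)) = d then 1 else 0)"
    unfolding U by (simp add: finite_increasing_lists flip: sum.inter_filter)
  also have "\<dots> = coefficient (\<Sum>js\<in>?I. monomial (\<Sum>k<length J. Poly_Mapping.single (bs ! (js ! k)) (J ! k))) d"
    using coefficient_scaled_sum [of "\<lambda>_. 1"
        "\<lambda>js. monomial (\<Sum>k<length J. Poly_Mapping.single (bs ! (js ! k)) (J ! k))" ?I d]
    by (simp add: monomial_def eq_commute)
  finally show "coefficient (substitute bs (qsym_M J)) d = \<dots>" .
qed

lemma substitute_qsym_M_Nil: "substitute bs (qsym_M []) = 1"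
  by (simp add: substitute_qsym_M increasing_lists_0)

lemma substitute_Nil_qsym_M: "J \<in> all_compositions \<Longrightarrow> substitute [] (qsym_M J) = (if J = [] then 1 else 0)"
  by (cases J) (simp_all add: substitute_qsym_M increasing_lists_0 increasing_lists_empty)

lemma substitute_Cons_qsym_M:
  assumes "j # J \<in> all_compositions"
  shows "substitute (b # bs) (qsym_M (j # J))
    = substitute bs (qsym_M (j # J)) + monomial (Poly_Mapping.single b j) * substitute bs (qsym_M J)"
proof -
  let ?N = "length bs" and ?l = "length J"
  let ?g = "\<lambda>js. monomial (\<Sum>k<Suc ?l. Poly_Mapping.single ((b # bs) ! (js ! k)) ((j # J) ! k))"
  have "substitute (b # bs) (qsym_M (j # J))
      = sum ?g (map Suc ` increasing_lists ?N (Suc ?l)) + sum ?g ((\<lambda>js. 0 # map Suc js) ` increasing_lists ?N ?l)"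
    using assms
    by (subst sum.union_disjoint [symmetric])
       (auto simp: substitute_qsym_M increasing_lists_Suc finite_increasing_lists simp del: sum.lessThan_Suc)
  also have "sum ?g (map Suc ` increasing_lists ?N (Suc ?l)) = substitute bs (qsym_M (j # J))"
    using assms
    by (subst sum.reindex) (auto simp: inj_on_def substitute_qsym_M increasing_lists_def simp del: sum.lessThan_Suc
        intro!: sum.cong arg_cong [where f = monomial])
  also have "sum ?g ((\<lambda>js. 0 # map Suc js) ` increasing_lists ?N ?l)
      = monomial (Poly_Mapping.single b j) * substitute bs (qsym_M J)"
    using assms
    by (subst sum.reindex) (auto simp: inj_on_def substitute_qsym_M increasing_lists_def sum_distrib_left
        sum.lessThan_Suc_shift monomial_add simp del: sum.lessThan_Suc
        intro!: sum.cong arg_cong [where f = monomial])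
  finally show ?thesis .
qed

lemma take_drop_composition:
  "J \<in> all_compositions \<Longrightarrow> take i J \<in> all_compositions"
  "J \<in> all_compositions \<Longrightarrow> drop i J \<in> all_compositions"
  by (auto simp: all_compositions_def dest: in_set_takeD in_set_dropD)

text \<open>Juxtaposing alphabets realises the coproduct: an increasing choice of positions takes an
  initial segment of the parts from \<open>bs\<close> and the rest from \<open>cs\<close>.\<close>

lemma substitute_append_qsym_M:
  "J \<in> all_compositions \<Longrightarrow> substitute (bs @ cs) (qsym_M J)
    = (\<Sum>i\<le>length J. substitute bs (qsym_M (take i J)) * substitute cs (qsym_M (drop i J)))"
proof (induction bs arbitrary: J)
  case Nil
  have "(\<Sum>i\<le>length J. substitute [] (qsym_M (take i J)) * substitute cs (qsym_M (drop i J)))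
      = (\<Sum>i\<le>length J. if i = 0 then substitute cs (qsym_M J) else 0)"
    using Nil by (intro sum.cong) (auto simp: substitute_Nil_qsym_M take_drop_composition)
  then show ?case by simp
next
  case (Cons b bs)
  show ?case
  proof (cases J)
    case Nil
    then show ?thesis by (simp add: substitute_qsym_M_Nil)
  next
    case (Cons j J')
    let ?g = "\<lambda>i. substitute cs (qsym_M (drop i J'))"
    let ?m = "monomial (Poly_Mapping.single b j)"
    have J: "J' \<in> all_compositions" "0 < j" using Cons.prems Cons by auto
    have "substitute ((b # bs) @ cs) (qsym_M J)
        = substitute (bs @ cs) (qsym_M (j # J')) + ?m * substitute (bs @ cs) (qsym_M J')"
      using J Cons by (simp add: substitute_Cons_qsym_M)
    also have "\<dots> = (substitute cs (qsym_M J)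
        + (\<Sum>i\<le>length J'. substitute bs (qsym_M (j # take i J')) * ?g i))
        + (\<Sum>i\<le>length J'. ?m * substitute bs (qsym_M (take i J')) * ?g i)"
      using J Cons Cons.IH
      by (simp add: sum.atMost_Suc_shift substitute_qsym_M_Nil sum_distrib_left mult.assoc del: sum.atMost_Suc)
    also have "\<dots> = substitute cs (qsym_M J)
        + (\<Sum>i\<le>length J'. (substitute bs (qsym_M (j # take i J')) + ?m * substitute bs (qsym_M (take i J'))) * ?g i)"
      by (simp add: distrib_right sum.distrib add.assoc)
    also have "\<dots> = (\<Sum>i\<le>length J. substitute (b # bs) (qsym_M (take i J)) * substitute cs (qsym_M (drop i J)))"
      using J Cons
      by (simp add: sum.atMost_Suc_shift substitute_qsym_M_Nil substitute_Cons_qsym_M take_drop_composition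
          del: sum.atMost_Suc)
    finally show ?thesis .
  qed
qed

lemma substitute_concat_qsym_M:
  "J \<in> all_compositions \<Longrightarrow> substitute (concat bss) (qsym_M J)
    = (\<Sum>Js\<in>cuts (length bss) J. \<Prod>s<length bss. substitute (bss ! s) (qsym_M (Js ! s)))"
proof (induction bss arbitrary: J)
  case Nil
  then show ?case by (simp add: substitute_Nil_qsym_M cuts_0)
next
  case (Cons bs bss)
  then show ?case
    by (simp add: substitute_append_qsym_M sum_cuts_Suc prod.lessThan_Suc_shift take_drop_composition
        sum_distrib_left del: prod.lessThan_Suc)
qed

text \<open>All letters coincide, so only the number of choices of positions matters; the induction
  is Pascal's rule.\<close>

lemma substitute_replicate_qsym_M:
  "J \<in> all_compositions \<Longrightarrow> substitute (replicate m b) (qsym_M J)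
    = real (m choose length J) *\<^sub>R monomial (Poly_Mapping.single b (sum_list J))"
proof (induction m arbitrary: J)
  case 0
  then show ?case by (cases J) (simp_all add: substitute_Nil_qsym_M)
next
  case (Suc m)
  show ?case
  proof (cases J)
    case (Cons j J')
    then show ?thesis
      using Suc by (simp add: substitute_Cons_qsym_M single_add monomial_add scaleR_add_left add.commute)
  qed (simp add: substitute_qsym_M_Nil)
qed

text \<open>Evaluation is multiplicative, so multiplying the values of all tensor factors at the
  same \<open>bs\<close> is evaluation at \<open>a\<close> juxtaposed copies of
  \<open>bs\<close>.\<close>

lemma substitute_hopf_power_qsym_F:
  assumes J: "J \<in> all_compositions" and a: "1 \<le> a"
  shows "substitute bs (hopf_power a (qsym_F J))
    = (\<Sum>K | refines K J. substitute (concat (replicate a bs)) (qsym_M K))"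
  unfolding hopf_power_qsym_F [OF assms] substitute_sum sum_refinement_cuts substitute_prod_list
proof (intro sum.cong refl)
  fix K assume "K \<in> {K. refines K J}"
  then have "K \<in> all_compositions" by (simp add: refines_def)
  then show "(\<Sum>t\<in>cuts a K. prod_list (map (substitute bs) (map qsym_M t)))
      = substitute (concat (replicate a bs)) (qsym_M K)"
    by (simp add: substitute_concat_qsym_M prod_list_eq_prod_nth cuts_def)
qed

section \<open>Extraction of multilinear coefficients\<close>

definition binomial_poly :: "nat \<Rightarrow> real poly" where
  "binomial_poly l = smult (1 / fact l) (\<Prod>i<l. [:- of_nat i, 1:])"

lemma poly_binomial_poly: "poly (binomial_poly l) (of_nat m) = of_nat (m choose l)"
  by (simp add: binomial_poly_def poly_prod binomial_gbinomial gbinomial_prod_rev atLeast0LessThan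
      add.commute [of "- _"])

lemma degree_binomial_poly: "degree (binomial_poly l) \<le> l"
proof -
  have "degree (\<Prod>i<l. [:- of_nat i, 1:] :: real poly) \<le> (\<Sum>i<l. 1)"
    by (rule order_trans [OF degree_prod_sum_le]) simp_all
  then show ?thesis by (simp add: binomial_poly_def)
qed

lemma coeff_0_binomial_poly: "coeff (binomial_poly l) 0 = (if l = 0 then 1 else 0)"
  using poly_binomial_poly [of l 0] by (cases l) (simp_all add: poly_0_coeff_0)

text \<open>In the falling factorial the factor with \<open>i = 0\<close> supplies the variable and
  the others supply their constant terms.\<close>

lemma coeff_1_binomial_poly: "coeff (binomial_poly l) 1 = (-1) ^ (l - 1) / of_nat l"
proof (cases l)
  case (Suc k)
  have "coeff (\<Prod>i<k. [:- of_nat (Suc i), 1:] :: real poly) 0 = (\<Prod>i<k. - of_nat (Suc i))"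
    by (simp flip: poly_0_coeff_0 add: poly_prod)
  also have "\<dots> = (-1) ^ k * fact k"
    by (induction k) (simp_all add: algebra_simps)
  finally show ?thesis
    unfolding Suc binomial_poly_def
    by (simp add: prod.lessThan_Suc_shift coeff_pCons_Suc del: prod.lessThan_Suc)
qed (simp add: binomial_poly_def)

text \<open>The linear coefficient is the derivative at 0, so this is the product rule.\<close>

lemma coeff_1_prod:
  fixes p :: "'b \<Rightarrow> 'a::{comm_semiring_1, semiring_no_zero_divisors} poly"
  shows "coeff (\<Prod>s\<in>B. p s) 1 = (\<Sum>s\<in>B. coeff (p s) 1 * (\<Prod>t\<in>B - {s}. coeff (p t) 0))"
proof -
  have eq: "coeff q 1 = poly (pderiv q) 0" for q :: "'a poly"
    by (simp add: poly_0_coeff_0 coeff_pderiv)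
  show ?thesis
    unfolding eq pderiv_prod poly_sum poly_mult poly_prod poly_0_coeff_0 [symmetric]
    by (simp add: mult.commute)
qed

text \<open>Lagrange interpolation at 0, ..., n; the weights are the linear coefficients of the
  basis polynomials \<open>L m\<close>. Extraction thus becomes a finite combination of values at
  natural numbers, which can serve as multiplicities in an alphabet.\<close>

lemma ex_linear_coeff_weights:
  "\<exists>v :: nat \<Rightarrow> real. \<forall>p. degree p \<le> n \<longrightarrow> (\<Sum>m\<le>n. v m * poly p (of_nat m)) = coeff p 1"
proof -
  define L :: "nat \<Rightarrow> real poly" where
    "L m = (\<Prod>j\<in>{..n} - {m}. smult (1 / (of_nat m - of_nat j)) [:- of_nat j, 1:])" for m
  have L: "poly (L m) (of_nat j) = (if j = m then 1 else 0)" if "m \<le> n" "j \<le> n" for m j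
  proof (cases "j = m")
    case False
    then have "j \<in> {..n} - {m}" using that by simp
    then show ?thesis using False by (auto simp: L_def poly_prod intro!: prod_zero bexI [of _ j])
  next
    case True
    then show ?thesis by (auto simp: L_def poly_prod divide_simps intro!: prod.neutral)
  qed
  have deg: "degree (L m) \<le> n" if "m \<le> n" for m
  proof -
    have "degree (L m) \<le> (\<Sum>j\<in>{..n} - {m}. 1)"
      unfolding L_def by (rule order_trans [OF degree_prod_sum_le]) (auto intro!: sum_mono)
    then show ?thesis using that by simp
  qed
  have "(\<Sum>m\<le>n. coeff (L m) 1 * poly p (of_nat m)) = coeff p 1" if "degree p \<le> n" for p
  proof -
    have "p = (\<Sum>m\<le>n. smult (poly p (of_nat m)) (L m))"
    proof (rule poly_eqI_degree [where A = "of_nat ` {..n}"])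
      fix x :: real assume "x \<in> of_nat ` {..n}"
      then obtain j where "x = of_nat j" "j \<le> n" by auto
      then show "poly p x = poly (\<Sum>m\<le>n. smult (poly p (of_nat m)) (L m)) x"
        by (simp add: poly_sum L if_distrib [where f = "(*) _"] cong: if_cong)
    next
      have "card (of_nat ` {..n} :: real set) = Suc n"
        by (simp add: card_image)
      moreover have "degree (\<Sum>m\<le>n. smult (poly p (of_nat m)) (L m)) \<le> n"
        by (rule degree_sum_le) (auto intro: order_trans [OF degree_smult_le] deg)
      ultimately show "degree p < card (of_nat ` {..n} :: real set)"
        "degree (\<Sum>m\<le>n. smult (poly p (of_nat m)) (L m)) < card (of_nat ` {..n} :: real set)"
        using that by simp_all
    qed
    then have "coeff p 1 = coeff (\<Sum>m\<le>n. smult (poly p (of_nat m)) (L m)) 1" by (rule arg_cong)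
    also have "\<dots> = (\<Sum>m\<le>n. coeff (L m) 1 * poly p (of_nat m))"
      by (simp add: coeff_sum mult.commute)
    finally show ?thesis by (rule sym)
  qed
  then show ?thesis by (intro exI allI impI)
qed

lemma prod_list_map_nths:
  "prod_list (map f (nths xs A)) = (\<Prod>s<length xs. if s \<in> A then f (xs ! s) else 1)"
  by (induction xs arbitrary: A)
     (simp_all add: nths_Cons prod.lessThan_Suc_shift del: prod.lessThan_Suc cong: if_cong)

lemma nths_eq_iff:
  "length xs = length ys \<Longrightarrow>
    nths xs A = nths ys A \<longleftrightarrow> (\<forall>s<length xs. s \<in> A \<longrightarrow> xs ! s = ys ! s)"
proof (induction xs ys arbitrary: A rule: list_induct2)
  case (Cons x xs y ys)
  then show ?case by (simp add: nths_Cons All_less_Suc2)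
qed simp

text \<open>Empty pieces add nothing to the concatenation, so deleting those outside
  \<open>A\<close> loses no information.\<close>

lemma sum_cuts_nths:
  "(\<Sum>Js\<in>cuts N K. if \<forall>s<N. s \<notin> A \<longrightarrow> Js ! s = [] then g (nths Js A) else 0)
    = (\<Sum>Ks\<in>cuts (card {s. s < N \<and> s \<in> A}) K. g Ks)"
proof (induction N arbitrary: A K g)
  case 0
  then show ?case by (simp add: cuts_0)
next
  case (Suc N)
  define A' where "A' = {s. Suc s \<in> A}"
  have card: "card {s. s < Suc N \<and> s \<in> A} = (if 0 \<in> A then Suc else id) (card {s. s < N \<and> s \<in> A'})"
  proof -
    have "{s. s < Suc N \<and> s \<in> A} = (if 0 \<in> A then {0} else {}) \<union> Suc ` {s. s < N \<and> s \<in> A'}"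
      by (auto simp: A'_def image_iff less_Suc_eq_0_disj)
    then show ?thesis by (simp add: card_image)
  qed
  have "(\<Sum>Js\<in>cuts (Suc N) K. if \<forall>s<Suc N. s \<notin> A \<longrightarrow> Js ! s = [] then g (nths Js A) else 0)
      = (\<Sum>j\<le>length K. \<Sum>Js\<in>cuts N (drop j K). if (0 \<notin> A \<longrightarrow> take j K = []) \<and> (\<forall>s<N. s \<notin> A' \<longrightarrow> Js ! s = [])
          then g ((if 0 \<in> A then [take j K] else []) @ nths Js A') else 0)"
    unfolding sum_cuts_Suc by (intro sum.cong) (auto simp: nths_Cons A'_def All_less_Suc2)
  also have "\<dots> = (\<Sum>Ks\<in>cuts (card {s. s < Suc N \<and> s \<in> A}) K. g Ks)"
  proof (cases "0 \<in> A")
    case True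
    then show ?thesis
      by (simp add: card sum_cuts_Suc Suc.IH [where A = A', symmetric] cong: if_cong)
  next
    case False
    have "(\<Sum>j\<le>length K. \<Sum>Js\<in>cuts N (drop j K). if (0 \<notin> A \<longrightarrow> take j K = []) \<and> (\<forall>s<N. s \<notin> A' \<longrightarrow> Js ! s = [])
          then g ((if 0 \<in> A then [take j K] else []) @ nths Js A') else 0)
      = (\<Sum>j\<le>length K. if j = 0 then (\<Sum>Js\<in>cuts N K. if \<forall>s<N. s \<notin> A' \<longrightarrow> Js ! s = [] then g (nths Js A') else 0) else 0)"
    proof (rule sum.cong [OF refl])
      fix j assume "j \<in> {..length K}"
      \<comment> \<open>Outside \<open>A\<close> the first piece must be empty, which leaves the
        single cut point 0.\<close>
      then have "take j K = [] \<longleftrightarrow> j = 0" by auto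
      then show "(\<Sum>Js\<in>cuts N (drop j K). if (0 \<notin> A \<longrightarrow> take j K = []) \<and> (\<forall>s<N. s \<notin> A' \<longrightarrow> Js ! s = [])
          then g ((if 0 \<in> A then [take j K] else []) @ nths Js A') else 0)
        = (if j = 0 then (\<Sum>Js\<in>cuts N K. if \<forall>s<N. s \<notin> A' \<longrightarrow> Js ! s = [] then g (nths Js A') else 0) else 0)"
        using False by (simp cong: if_cong del: take_eq_Nil take_eq_Nil2)
    qed
    then show ?thesis using False by (simp add: card Suc.IH cong: if_cong)
  qed
  finally show ?case .
qed

text \<open>A binomial polynomial has constant term 1 for length 0 and 0 otherwise, so a linear term
  arises from one factor while all the others come from empty pieces. The length bound keeps the
  degree within the range of the weights.\<close>

lemma linear_coeff_prod_binomial: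
  assumes v: "\<And>p. degree p \<le> n \<Longrightarrow> (\<Sum>m\<le>n. v m * poly p (of_nat m)) = coeff p 1"
    and "finite B" "(\<Sum>s\<in>B. length (J s)) \<le> n"
  shows "(\<Sum>m\<le>n. v m * (\<Prod>s\<in>B. real (m choose length (J s))))
    = (\<Sum>s\<in>B. log_weight (J s) * (if \<forall>t\<in>B. t \<noteq> s \<longrightarrow> J t = [] then 1 else 0))"
proof -
  let ?p = "\<Prod>s\<in>B. binomial_poly (length (J s))"
  have "degree ?p \<le> (\<Sum>s\<in>B. length (J s))"
    by (rule order_trans [OF degree_prod_sum_le [OF \<open>finite B\<close>]])
       (auto intro!: sum_mono degree_binomial_poly)
  then have "(\<Sum>m\<le>n. v m * poly ?p (of_nat m)) = coeff ?p 1"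
    using v assms by (meson order_trans)
  then have "(\<Sum>m\<le>n. v m * (\<Prod>s\<in>B. real (m choose length (J s)))) = coeff ?p 1"
    by (simp add: poly_prod poly_binomial_poly)
  also have "\<dots> = (\<Sum>s\<in>B. log_weight (J s) * (\<Prod>t\<in>B - {s}. if J t = [] then 1 else 0))"
    using \<open>finite B\<close>
    by (simp only: coeff_1_prod coeff_0_binomial_poly coeff_1_binomial_poly log_weight_def length_0_conv)
  also have "\<dots> = (\<Sum>s\<in>B. log_weight (J s) * (if \<forall>t\<in>B. t \<noteq> s \<longrightarrow> J t = [] then 1 else 0))"
  proof (intro sum.cong refl arg_cong [where f = "(*) _"])
    fix s
    show "(\<Prod>t\<in>B - {s}. if J t = [] then 1 else 0)
        = (if \<forall>t\<in>B. t \<noteq> s \<longrightarrow> J t = [] then 1 else (0::real))"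
      using \<open>finite B\<close> by (auto intro!: prod.neutral prod_zero)
  qed
  finally show ?thesis .
qed

section \<open>Functionals attached to words\<close>

definition label_sum :: "nat list \<Rightarrow> (nat \<Rightarrow>\<^sub>0 nat)" where
  "label_sum L = (\<Sum>r<length L. Poly_Mapping.single r (L ! r))"

text \<open>An element selects, for every letter, the occurrence that supplies the linear factor in
  its multiplicity; \<open>PiE\<close> fixes the values elsewhere so that choices can be
  counted.\<close>

definition choice_functions :: "nat list \<Rightarrow> nat \<Rightarrow> (nat \<Rightarrow> nat) set" where
  "choice_functions w k = PiE {..<k} (\<lambda>r. {s. s < length w \<and> w ! s = r})"

text \<open>With the weights \<open>v\<close> of \<open>ex_linear_coeff_weights\<close>, this is the coefficient of
  \<open>m 0 \<cdots> m (k - 1)\<close> and of the monomial with exponents \<open>L\<close> in the evaluation of \<open>f\<close> at the alphabet that lists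
  \<open>m r\<close> copies of the variable \<open>r\<close> for every letter \<open>r\<close> of \<open>w\<close>.\<close>

definition word_functional ::
    "nat \<Rightarrow> (nat \<Rightarrow> real) \<Rightarrow> nat list \<Rightarrow> nat list \<Rightarrow> power_series \<Rightarrow> real" where
  "word_functional n v w L f = (\<Sum>m\<in>PiE {..<length L} (\<lambda>_. {..n}). (\<Prod>r<length L. v (m r)) *
     coefficient (substitute (concat (map (\<lambda>r. replicate (m r) r) w)) f) (label_sum L))"

lemma prod_scaleR:
  fixes f :: "'a \<Rightarrow> 'b::{real_algebra_1, comm_ring_1}"
  shows "(\<Prod>x\<in>A. c x *\<^sub>R f x) = (\<Prod>x\<in>A. c x) *\<^sub>R (\<Prod>x\<in>A. f x)"
  by (induction A rule: infinite_finite_induct) simp_all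

lemma coefficient_substitute_word:
  assumes "K \<in> all_compositions"
  shows "coefficient (substitute (concat (map (\<lambda>r. replicate (m r) r) w)) (qsym_M K)) d
    = (\<Sum>Js\<in>cuts (length w) K.
        if (\<Sum>s<length w. Poly_Mapping.single (w ! s) (sum_list (Js ! s))) = d
        then \<Prod>s<length w. real (m (w ! s) choose length (Js ! s)) else 0)"
proof -
  have "substitute (concat (map (\<lambda>r. replicate (m r) r) w)) (qsym_M K)
      = (\<Sum>Js\<in>cuts (length w) K. (\<Prod>s<length w. real (m (w ! s) choose length (Js ! s))) *\<^sub>R
          monomial (\<Sum>s<length w. Poly_Mapping.single (w ! s) (sum_list (Js ! s))))"
    unfolding substitute_concat_qsym_M [OF assms] length_map
  proof (intro sum.cong refl)
    fix Js assume "Js \<in> cuts (length w) K"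
    then have Js: "Js ! s \<in> all_compositions" if "s < length w" for s
      using assms that by (auto simp: cuts_def all_compositions_def)
    have "(\<Prod>s<length w. substitute (map (\<lambda>r. replicate (m r) r) w ! s) (qsym_M (Js ! s)))
        = (\<Prod>s<length w. real (m (w ! s) choose length (Js ! s)) *\<^sub>R
            monomial (Poly_Mapping.single (w ! s) (sum_list (Js ! s))))"
      using Js by (intro prod.cong) (simp_all add: substitute_replicate_qsym_M)
    then show "(\<Prod>s<length w. substitute (map (\<lambda>r. replicate (m r) r) w ! s) (qsym_M (Js ! s)))
        = (\<Prod>s<length w. real (m (w ! s) choose length (Js ! s))) *\<^sub>R
          monomial (\<Sum>s<length w. Poly_Mapping.single (w ! s) (sum_list (Js ! s)))"
      by (simp add: prod_scaleR monomial_sum)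
  qed
  then show ?thesis
    by (simp add: coefficient_scaled_sum monomial_def if_distrib [where f = "(*) _"] eq_commute cong: if_cong)
qed

text \<open>Evaluation along \<open>w\<close> cuts \<open>K\<close> into one piece per position.
  Linearity in the multiplicity of \<open>r\<close> selects one occurrence \<open>\<sigma> r\<close>
  and empties the pieces at all others. The selected pieces, read in the order of \<open>w\<close>,
  cut \<open>K\<close> along \<open>L\<close> permuted accordingly.\<close>

lemma word_functional_qsym_M:
  assumes v: "\<And>p. degree p \<le> n \<Longrightarrow> (\<Sum>m\<le>n. v m * poly p (of_nat m)) = coeff p 1"
    and w: "set w \<subseteq> {..<length L}"
    and K: "K \<in> compositions n"
  shows "word_functional n v w L (qsym_M K) =
    (\<Sum>\<sigma>\<in>choice_functions w (length L).
      split_weight (map ((!) L) (nths w (\<sigma> ` {..<length L}))) K)"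
proof -
  define k N where "k = length L" and "N = length w"
  define B where "B r = {s. s < N \<and> w ! s = r}" for r
  have wk: "w ! s < k" if "s < N" for s
  proof -
    have "w ! s \<in> set w" using that by (simp add: N_def)
    with w have "w ! s \<in> {..<k}" unfolding k_def by blast
    then show ?thesis by simp
  qed
  define ok where "ok Js \<longleftrightarrow> (\<Sum>s<N. Poly_Mapping.single (w ! s) (sum_list (Js ! s))) = label_sum L"
    for Js :: "nat list list"
  have fin: "finite (B r)" for r by (simp add: B_def)
  have choice: "choice_functions w k = PiE {..<k} B"
    by (simp add: choice_functions_def B_def [abs_def] N_def)
  have K': "K \<in> all_compositions" "length K \<le> n"
    using K length_le_sum_list by (auto simp: compositions_iff)
  \<comment> \<open>For a fixed cut the sum over \<open>m\<close> factors into one linear extraction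
    per letter; multiplying out the results produces the choices \<open>\<sigma>\<close>.\<close>
  have expand: "(\<Sum>m\<in>PiE {..<k} (\<lambda>_. {..n}). (\<Prod>r<k. v (m r)) * (\<Prod>s<N. real (m (w ! s) choose length (Js ! s))))
      = (\<Sum>\<sigma>\<in>PiE {..<k} B. (\<Prod>r<k. log_weight (Js ! \<sigma> r)) *
          (if \<forall>s<N. s \<notin> \<sigma> ` {..<k} \<longrightarrow> Js ! s = [] then 1 else 0))"
    if Js: "Js \<in> cuts N K" for Js
  proof -
    have "(\<Sum>m\<in>PiE {..<k} (\<lambda>_. {..n}). (\<Prod>r<k. v (m r)) * (\<Prod>s<N. real (m (w ! s) choose length (Js ! s))))
        = (\<Sum>m\<in>PiE {..<k} (\<lambda>_. {..n}). \<Prod>r<k. v (m r) * (\<Prod>s\<in>B r. real (m r choose length (Js ! s))))"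
    proof (intro sum.cong refl)
      fix m :: "nat \<Rightarrow> nat"
      \<comment> \<open>Grouping positions by letter isolates the factors that depend on
        \<open>m r\<close>.\<close>
      have "(\<Prod>s<N. real (m (w ! s) choose length (Js ! s)))
          = (\<Prod>r<k. \<Prod>s\<in>{s. s \<in> {..<N} \<and> w ! s = r}. real (m (w ! s) choose length (Js ! s)))"
        using wk by (intro prod.group [symmetric]) auto
      also have "\<dots> = (\<Prod>r<k. \<Prod>s\<in>B r. real (m r choose length (Js ! s)))"
        by (intro prod.cong) (auto simp: B_def)
      finally show "(\<Prod>r<k. v (m r)) * (\<Prod>s<N. real (m (w ! s) choose length (Js ! s)))
          = (\<Prod>r<k. v (m r) * (\<Prod>s\<in>B r. real (m r choose length (Js ! s))))"
        by (simp add: prod.distrib)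
    qed
    also have "\<dots> = (\<Prod>r<k. \<Sum>m\<le>n. v m * (\<Prod>s\<in>B r. real (m choose length (Js ! s))))"
      by (rule prod_sum_PiE [symmetric]) auto
    also have "\<dots> = (\<Prod>r<k. \<Sum>s\<in>B r. log_weight (Js ! s) *
        (if \<forall>t\<in>B r. t \<noteq> s \<longrightarrow> Js ! t = [] then 1 else 0))"
    proof (rule prod.cong [OF refl], rule linear_coeff_prod_binomial [OF v fin])
      fix r
      have "(\<Sum>s\<in>B r. length (Js ! s)) \<le> (\<Sum>s<N. length (Js ! s))"
        by (rule sum_mono2) (auto simp: B_def)
      also have "\<dots> = length (concat Js)"
      proof -
        have "length Js = N" using Js by (simp add: cuts_def)
        then show ?thesis by (simp add: length_concat sum_list_sum_nth atLeast0LessThan)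
      qed
      also have "\<dots> \<le> n" using Js K' by (simp add: cuts_def)
      finally show "(\<Sum>s\<in>B r. length (Js ! s)) \<le> n" .
    qed
    also have "\<dots> = (\<Sum>\<sigma>\<in>PiE {..<k} B. \<Prod>r<k. log_weight (Js ! \<sigma> r) *
        (if \<forall>t\<in>B r. t \<noteq> \<sigma> r \<longrightarrow> Js ! t = [] then 1 else 0))"
      by (rule prod_sum_PiE) (auto simp: fin)
    also have "\<dots> = (\<Sum>\<sigma>\<in>PiE {..<k} B. (\<Prod>r<k. log_weight (Js ! \<sigma> r)) *
          (if \<forall>s<N. s \<notin> \<sigma> ` {..<k} \<longrightarrow> Js ! s = [] then 1 else 0))"
    proof (rule sum.cong [OF refl])
      fix \<sigma> assume \<sigma>: "\<sigma> \<in> PiE {..<k} B"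
      have w\<sigma>: "w ! \<sigma> r = r" if "r < k" for r
        using PiE_mem [OF \<sigma>, of r] that by (simp add: B_def)
      have mem: "s \<in> \<sigma> ` {..<k} \<longleftrightarrow> s = \<sigma> (w ! s)" if "s < N" for s
        using wk [OF that] w\<sigma> by auto
      have "(\<forall>s<N. s \<notin> \<sigma> ` {..<k} \<longrightarrow> Js ! s = []) \<longleftrightarrow> (\<forall>r<k. \<forall>t\<in>B r. t \<noteq> \<sigma> r \<longrightarrow> Js ! t = [])"
        using mem wk by (auto simp: B_def)
      moreover have "(\<Prod>r<k. if P r then 1 else 0) = (if \<forall>r<k. P r then 1 else (0::real))" for P
        by (auto intro!: prod.neutral prod_zero)
      ultimately show "(\<Prod>r<k. log_weight (Js ! \<sigma> r) * (if \<forall>t\<in>B r. t \<noteq> \<sigma> r \<longrightarrow> Js ! t = [] then 1 else 0))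
          = (\<Prod>r<k. log_weight (Js ! \<sigma> r)) * (if \<forall>s<N. s \<notin> \<sigma> ` {..<k} \<longrightarrow> Js ! s = [] then 1 else (0::real))"
        by (simp add: prod.distrib)
    qed
    finally show ?thesis .
  qed
  have "word_functional n v w L (qsym_M K) = (\<Sum>m\<in>PiE {..<k} (\<lambda>_. {..n}). \<Sum>Js\<in>cuts N K.
      if ok Js then (\<Prod>r<k. v (m r)) * (\<Prod>s<N. real (m (w ! s) choose length (Js ! s))) else 0)"
    unfolding word_functional_def coefficient_substitute_word [OF K'(1)] ok_def k_def N_def sum_distrib_left
    by (intro sum.cong refl) simp
  also have "\<dots> = (\<Sum>Js\<in>cuts N K. \<Sum>m\<in>PiE {..<k} (\<lambda>_. {..n}).
      if ok Js then (\<Prod>r<k. v (m r)) * (\<Prod>s<N. real (m (w ! s) choose length (Js ! s))) else 0)"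
    by (rule sum.swap)
  also have "\<dots> = (\<Sum>Js\<in>cuts N K. \<Sum>\<sigma>\<in>PiE {..<k} B. if ok Js then (\<Prod>r<k. log_weight (Js ! \<sigma> r)) *
          (if \<forall>s<N. s \<notin> \<sigma> ` {..<k} \<longrightarrow> Js ! s = [] then 1 else 0) else 0)"
  proof (rule sum.cong [OF refl])
    fix Js assume "Js \<in> cuts N K"
    from expand [OF this]
    show "(\<Sum>m\<in>PiE {..<k} (\<lambda>_. {..n}).
        if ok Js then (\<Prod>r<k. v (m r)) * (\<Prod>s<N. real (m (w ! s) choose length (Js ! s))) else 0)
      = (\<Sum>\<sigma>\<in>PiE {..<k} B. if ok Js then (\<Prod>r<k. log_weight (Js ! \<sigma> r)) *
          (if \<forall>s<N. s \<notin> \<sigma> ` {..<k} \<longrightarrow> Js ! s = [] then 1 else 0) else 0)"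
      by (cases "ok Js") simp_all
  qed
  also have "\<dots> = (\<Sum>\<sigma>\<in>PiE {..<k} B. \<Sum>Js\<in>cuts N K. if ok Js then (\<Prod>r<k. log_weight (Js ! \<sigma> r)) *
          (if \<forall>s<N. s \<notin> \<sigma> ` {..<k} \<longrightarrow> Js ! s = [] then 1 else 0) else 0)"
    by (rule sum.swap)
  also have "\<dots> = (\<Sum>\<sigma>\<in>PiE {..<k} B. split_weight (map ((!) L) (nths w (\<sigma> ` {..<k}))) K)"
  proof (rule sum.cong [OF refl])
    fix \<sigma> assume "\<sigma> \<in> PiE {..<k} B"
    from PiE_mem [OF this] have \<sigma>: "w ! \<sigma> r = r" "\<sigma> r < N" if "r < k" for r
      using that by (simp_all add: B_def)
    define A where "A = \<sigma> ` {..<k}"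
    define L' where "L' = map ((!) L) (nths w A)"
    have inj: "inj_on \<sigma> {..<k}" using \<sigma> by (intro inj_onI) (metis lessThan_iff)
    have AN: "{s. s < N \<and> s \<in> A} = A" using \<sigma> by (auto simp: A_def)
    have cardA: "card A = k" using inj by (simp add: A_def card_image)
    define g :: "nat list list \<Rightarrow> real" where
      "g Ks = (if map sum_list Ks = L' then prod_list (map log_weight Ks) else 0)" for Ks
    have "(\<Sum>Js\<in>cuts N K. if ok Js then (\<Prod>r<k. log_weight (Js ! \<sigma> r)) *
          (if \<forall>s<N. s \<notin> A \<longrightarrow> Js ! s = [] then 1 else 0) else 0)
      = (\<Sum>Js\<in>cuts N K. if \<forall>s<N. s \<notin> A \<longrightarrow> Js ! s = [] then g (nths Js A) else 0)"
    proof (rule sum.cong [OF refl])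
      fix Js assume "Js \<in> cuts N K"
      then have len: "length Js = N" by (simp add: cuts_def)
      \<comment> \<open>With all other pieces empty, the exponent of variable \<open>r\<close> is
        the size of the piece at \<open>\<sigma> r\<close>, so the condition on the monomial
        prescribes the block sums.\<close>
      have "ok Js \<longleftrightarrow> map sum_list (nths Js A) = L'" if empty: "\<forall>s<N. s \<notin> A \<longrightarrow> Js ! s = []"
      proof -
        have lookup: "Poly_Mapping.lookup (\<Sum>s<N. Poly_Mapping.single (w ! s) (sum_list (Js ! s))) r
            = (if r < k then sum_list (Js ! \<sigma> r) else 0)" for r
        proof -
          have "Poly_Mapping.lookup (\<Sum>s<N. Poly_Mapping.single (w ! s) (sum_list (Js ! s))) r
              = (\<Sum>s<N. if w ! s = r then sum_list (Js ! s) else 0)"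
            by (simp add: lookup_sum lookup_single when_def)
          also have "\<dots> = (\<Sum>s<N. if r < k \<and> s = \<sigma> r then sum_list (Js ! \<sigma> r) else 0)"
          proof (intro sum.cong refl)
            fix s assume "s \<in> {..<N}"
            then show "(if w ! s = r then sum_list (Js ! s) else 0) = (if r < k \<and> s = \<sigma> r then sum_list (Js ! \<sigma> r) else 0)"
              using empty \<sigma>(1) wk [of s] by (auto simp: A_def image_iff)
          qed
          also have "\<dots> = (if r < k then sum_list (Js ! \<sigma> r) else 0)"
            using \<sigma>(2) [of r] by simp
          finally show ?thesis .
        qed
        have "Poly_Mapping.lookup (label_sum L) r = (if r < k then L ! r else 0)" for r
          by (simp add: label_sum_def k_def lookup_sum lookup_single when_def)
        then have "ok Js \<longleftrightarrow> (\<forall>r<k. sum_list (Js ! \<sigma> r) = L ! r)"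
          unfolding ok_def poly_mapping_eq_iff fun_eq_iff lookup by auto
        also have "\<dots> \<longleftrightarrow> (\<forall>s<N. s \<in> A \<longrightarrow> map sum_list Js ! s = map ((!) L) w ! s)"
          using \<sigma> len by (auto simp: A_def N_def)
        also have "\<dots> \<longleftrightarrow> map sum_list (nths Js A) = L'"
          using nths_eq_iff [of "map sum_list Js" "map ((!) L) w" A] len
          by (simp add: L'_def N_def nths_map)
        finally show ?thesis .
      qed
      moreover have "(\<Prod>r<k. log_weight (Js ! \<sigma> r)) = (prod_list (map log_weight (nths Js A)) :: real)"
      proof -
        have "(\<Prod>r<k. log_weight (Js ! \<sigma> r)) = (\<Prod>s\<in>A. log_weight (Js ! s) :: real)"
          unfolding A_def by (simp add: prod.reindex [OF inj])
        also have "\<dots> = (\<Prod>s<N. if s \<in> A then log_weight (Js ! s) else 1)"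
          using AN by (subst prod.inter_filter [symmetric]) (auto intro!: prod.cong)
        finally show ?thesis by (simp add: prod_list_map_nths len)
      qed
      ultimately show "(if ok Js then (\<Prod>r<k. log_weight (Js ! \<sigma> r)) *
          (if \<forall>s<N. s \<notin> A \<longrightarrow> Js ! s = [] then 1 else 0) else 0)
        = (if \<forall>s<N. s \<notin> A \<longrightarrow> Js ! s = [] then g (nths Js A) else 0)"
        by (cases "\<forall>s<N. s \<notin> A \<longrightarrow> Js ! s = []") (simp add: g_def, simp only: if_False mult_zero_right if_cancel)
    qed
    \<comment> \<open>Dropping the empty pieces leaves the cuts of \<open>K\<close> into
      \<open>k\<close> blocks.\<close>
    also have "\<dots> = (\<Sum>Ks\<in>cuts k K. g Ks)"
      by (simp add: sum_cuts_nths AN cardA)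
    also have "\<dots> = split_weight L' K"
    proof -
      have "length L' = k"
        using AN cardA by (simp add: L'_def length_nths N_def)
      then have "{Ks \<in> cuts k K. map sum_list Ks = L'} = {Ks. concat Ks = K \<and> map sum_list Ks = L'}"
        by (auto simp: cuts_def)
      then show ?thesis
        by (simp add: g_def split_weight_def finite_cuts flip: sum.inter_filter)
    qed
    finally show "(\<Sum>Js\<in>cuts N K. if ok Js then (\<Prod>r<k. log_weight (Js ! \<sigma> r)) *
          (if \<forall>s<N. s \<notin> \<sigma> ` {..<k} \<longrightarrow> Js ! s = [] then 1 else 0) else 0)
        = (split_weight (map ((!) L) (nths w (\<sigma> ` {..<k}))) K :: real)"
      by (simp only: A_def L'_def)
  qed
  finally show ?thesis unfolding choice [symmetric] unfolding k_def .
qed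

section \<open>The eigenfunction identity\<close>

lemma word_functional_linear:
  "word_functional n v w L (\<Sum>x\<in>A. c x *\<^sub>R f x) = (\<Sum>x\<in>A. c x * word_functional n v w L (f x))"
proof -
  have "coefficient (substitute bs (\<Sum>x\<in>A. c x *\<^sub>R f x)) d
      = (\<Sum>x\<in>A. c x * coefficient (substitute bs (f x)) d)" for bs d
    by (simp add: substitute_sum substitute_scaleR coefficient_scaled_sum)
  then have "word_functional n v w L (\<Sum>x\<in>A. c x *\<^sub>R f x)
      = (\<Sum>m\<in>PiE {..<length L} (\<lambda>_. {..n}). \<Sum>x\<in>A. c x * ((\<Prod>r<length L. v (m r)) *
          coefficient (substitute (concat (map (\<lambda>r. replicate (m r) r) w)) (f x)) (label_sum L)))"
    by (simp add: word_functional_def sum_distrib_left mult.left_commute)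
  also have "\<dots> = (\<Sum>x\<in>A. c x * word_functional n v w L (f x))"
    by (subst sum.swap) (simp add: word_functional_def sum_distrib_left)
  finally show ?thesis .
qed

lemma word_functional_sum:
  "word_functional n v w L (\<Sum>x\<in>A. f x) = (\<Sum>x\<in>A. word_functional n v w L (f x))"
  using word_functional_linear [of n v w L "\<lambda>_. 1" f A] by simp

text \<open>Repeating the alphabet amounts to repeating the word with the same
  multiplicities.\<close>

lemma word_functional_hopf_power:
  assumes "J \<in> all_compositions" "1 \<le> a"
  shows "word_functional n v w L (hopf_power a (qsym_F J))
    = (\<Sum>K | refines K J. word_functional n v (concat (replicate a w)) L (qsym_M K))"
proof -
  have "concat (replicate a (concat (map g w))) = concat (map g (concat (replicate a w)))" for g :: "nat \<Rightarrow> nat list"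
    by (induction a) simp_all
  then have "substitute (concat (map g w)) (hopf_power a (qsym_F J))
      = substitute (concat (map g (concat (replicate a w)))) (\<Sum>K | refines K J. qsym_M K)" for g
    by (simp add: substitute_hopf_power_qsym_F [OF assms] substitute_sum)
  then have "word_functional n v w L (hopf_power a (qsym_F J))
      = word_functional n v (concat (replicate a w)) L (\<Sum>K | refines K J. qsym_M K)"
    by (simp add: word_functional_def)
  then show ?thesis by (simp add: word_functional_sum)
qed

text \<open>Reading the chosen occurrences in word order lists every letter below \<open>k\<close>
  once, so a choice determines a permutation of the letters.\<close>

lemma mset_nths_choice:
  assumes "\<sigma> \<in> choice_functions w k"
  shows "mset (nths w (\<sigma> ` {..<k})) = mset [0..<k]"
proof -
  have \<sigma>: "w ! \<sigma> r = r" "\<sigma> r < length w" if "r < k" for r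
    using PiE_mem [OF assms [unfolded choice_functions_def], of r] that by simp_all
  have "inj_on \<sigma> {..<k}" using \<sigma> by (intro inj_onI) (metis lessThan_iff)
  moreover have "{s. s < length w \<and> s \<in> \<sigma> ` {..<k}} = \<sigma> ` {..<k}" using \<sigma> by auto
  ultimately have len: "length (nths w (\<sigma> ` {..<k})) = k"
    by (simp add: length_nths card_image)
  have set: "set (nths w (\<sigma> ` {..<k})) = {..<k}"
    using \<sigma> unfolding set_nths by force
  then have "distinct (nths w (\<sigma> ` {..<k}))"
    using len by (intro card_distinct) simp
  then show ?thesis
    using set set_eq_iff_mset_eq_distinct [of "nths w (\<sigma> ` {..<k})" "[0..<k]"]
    by (simp add: lessThan_atLeast0)
qed

text \<open>Permuting entries by \<open>p\<close> is an injective map of the finite set of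
  rearrangements into itself, hence a bijection.\<close>

lemma sum_rearrangements_permuted:
  assumes "mset p = mset [0..<length I]"
  shows "(\<Sum>L | mset L = mset I. g (map ((!) L) p)) = (\<Sum>L | mset L = mset I. g L)"
proof -
  let ?R = "{L. mset L = mset I}"
  have set: "set p = {..<length I}"
    using mset_eq_setD [OF assms] by (simp add: lessThan_atLeast0)
  have len: "length L = length I" if "mset L = mset I" for L
    using mset_eq_length [OF that] .
  have "mset (map ((!) L) p) = mset I" if L: "mset L = mset I" for L
  proof -
    have "mset (map ((!) L) p) = mset (map ((!) L) [0..<length I])"
      unfolding mset_map assms ..
    also have "map ((!) L) [0..<length I] = L" using map_nth [of L] len [OF L] by simp
    finally show ?thesis unfolding L .
  qed
  then have "(\<lambda>L. map ((!) L) p) ` ?R \<subseteq> ?R" by (simp add: image_subset_iff)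
  moreover have inj: "inj_on (\<lambda>L. map ((!) L) p) ?R"
  proof (rule inj_onI)
    fix L M assume "L \<in> ?R" "M \<in> ?R" and eq: "map ((!) L) p = map ((!) M) p"
    then have L: "length L = length I" and M: "length M = length I" using len by blast+
    show "L = M"
    proof (rule nth_equalityI)
      show "length L = length M" using L M by simp
      fix i assume "i < length L"
      then have "i \<in> set p" using L set by simp
      then show "L ! i = M ! i" using eq by simp
    qed
  qed
  moreover have "finite ?R"
    by (rule finite_subset [OF _ finite_lists_length_eq [of "set I" "length I"]])
       (auto dest: mset_eq_setD mset_eq_length)
  ultimately have "(\<lambda>L. map ((!) L) p) ` ?R = ?R" by (intro endo_inj_surj)
  then have "bij_betw (\<lambda>L. map ((!) L) p) ?R ?R" using inj by (simp add: bij_betw_def)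
  then show ?thesis by (rule sum.reindex_bij_betw)
qed

lemma card_choice_functions: "card (choice_functions (concat (replicate a [0..<k])) k) = a ^ k"
proof -
  have "length (filter (\<lambda>x. x = r) (concat (replicate a [0..<k]))) = a" if "r < k" for r
  proof (induction a)
    case (Suc a)
    have "length (filter (\<lambda>x. x = r) [0..<k]) = 1"
    proof -
      have "{i. i < k \<and> [0..<k] ! i = r} = {r}" using that by auto
      then show ?thesis by (simp add: length_filter_conv_card)
    qed
    with Suc show ?case by simp
  qed simp
  then show ?thesis
    unfolding choice_functions_def length_filter_conv_card
    by (simp add: card_PiE)
qed

text \<open>After the sums are exchanged, each choice only permutes the rearrangements and leaves
  the inner sum unchanged; the factor counts the choices.\<close>

lemma sum_word_functional:
  assumes v: "\<And>p. degree p \<le> n \<Longrightarrow> (\<Sum>m\<le>n. v m * poly p (of_nat m)) = coeff p 1"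
    and K: "K \<in> compositions n"
  shows "(\<Sum>L | mset L = mset I.
      word_functional n v (concat (replicate a [0..<length I])) L (qsym_M K))
    = real a ^ length I * (\<Sum>L | mset L = mset I. split_weight L K)"
proof -
  let ?k = "length I" and ?w = "concat (replicate a [0..<length I])"
  have len: "length L = ?k" if "mset L = mset I" for L
    using mset_eq_length [OF that] .
  have "(\<Sum>L | mset L = mset I. word_functional n v ?w L (qsym_M K))
      = (\<Sum>L | mset L = mset I. \<Sum>\<sigma>\<in>choice_functions ?w ?k.
          split_weight (map ((!) L) (nths ?w (\<sigma> ` {..<?k}))) K)"
  proof (rule sum.cong [OF refl])
    fix L assume "L \<in> {L. mset L = mset I}"
    then have "length L = ?k" using len by blast
    moreover have "set ?w \<subseteq> {..<?k}" by auto
    ultimately show "word_functional n v ?w L (qsym_M K) = (\<Sum>\<sigma>\<in>choice_functions ?w ?k.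
          split_weight (map ((!) L) (nths ?w (\<sigma> ` {..<?k}))) K)"
      using word_functional_qsym_M [OF v _ K, of ?w L] by metis
  qed
  also have "\<dots> = (\<Sum>\<sigma>\<in>choice_functions ?w ?k. \<Sum>L | mset L = mset I.
          split_weight (map ((!) L) (nths ?w (\<sigma> ` {..<?k}))) K)"
    by (rule sum.swap)
  also have "\<dots> = (\<Sum>\<sigma>\<in>choice_functions ?w ?k. \<Sum>L | mset L = mset I. split_weight L K)"
    by (intro sum.cong [OF refl] sum_rearrangements_permuted mset_nths_choice)
  finally show ?thesis by (simp add: card_choice_functions)
qed

lemma of_rat_log_weight: "of_rat (log_weight J) = (log_weight J :: 'a::field_char_0)"
  by (simp add: log_weight_def of_rat_divide of_rat_power)

lemma of_rat_split_weight: "of_rat (split_weight L K) = (split_weight L K :: 'a::field_char_0)"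
proof -
  have "of_rat (prod_list (map log_weight Ks)) = (prod_list (map log_weight Ks) :: 'a)" for Ks
    by (induction Ks) (simp_all add: of_rat_mult of_rat_log_weight)
  then show ?thesis by (simp add: split_weight_def of_rat_sum)
qed

lemma right_eigenfunction_eigen_fI:
  assumes a: "1 \<le> a" and I: "I \<in> compositions n"
  shows "right_eigenfunction (compositions n) (hopf_power_matrix a n)
            (real a powi (int (length I) - int n)) (\<lambda>J. of_rat (eigen_fI I J))"
  unfolding right_eigenfunction_def
proof
  fix J assume J: "J \<in> compositions n"
  obtain v :: "nat \<Rightarrow> real"
    where v: "\<And>p. degree p \<le> n \<Longrightarrow> (\<Sum>m\<le>n. v m * poly p (of_nat m)) = coeff p 1"
    using ex_linear_coeff_weights [of n] by blast
  let ?R = "{L. mset L = mset I}" and ?w = "[0..<length I]"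
  \<comment> \<open>This linear functional is built so that it sends F_K to f_I(K) and is multiplied
    by a^k, with k the length of \<open>I\<close>, under the Hopf power.\<close>
  define \<Phi> where "\<Phi> f = 1 / fact (length I) * (\<Sum>L\<in>?R. word_functional n v ?w L f)" for f
  have linear: "\<Phi> (\<Sum>x\<in>A. c x *\<^sub>R f x) = (\<Sum>x\<in>A. c x * \<Phi> (f x))"
    for A :: "nat list set" and c f
  proof -
    have "(\<Sum>L\<in>?R. word_functional n v ?w L (\<Sum>x\<in>A. c x *\<^sub>R f x))
        = (\<Sum>x\<in>A. c x * (\<Sum>L\<in>?R. word_functional n v ?w L (f x)))"
      unfolding word_functional_linear by (subst sum.swap) (simp add: sum_distrib_left)
    then show ?thesis by (simp add: \<Phi>_def sum_distrib_left mult.left_commute sum_divide_distrib)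
  qed
  have ref: "K \<in> compositions n" if "K \<in> {K. refines K J}" "J \<in> compositions n" for K J
    using that refines_compositions by (auto simp: compositions_iff)
  have of_rat_fact: "of_rat (fact m) = (fact m :: real)" for m
    by (metis of_nat_fact of_rat_of_nat_eq)
  have eigen: "of_rat (eigen_fI I J) = (1 / fact (length I) :: real) *
      (\<Sum>K | refines K J. \<Sum>L\<in>?R. split_weight L K)" if J: "J \<in> compositions n" for J
    unfolding eigen_fI_eq_sum_split_weight [OF I J]
    by (subst sum.swap) (simp add: of_rat_mult of_rat_divide of_rat_sum of_rat_split_weight of_rat_fact)
  have hopf: "\<Phi> (hopf_power b (qsym_F J)) = real b ^ length I * of_rat (eigen_fI I J)"
    if b: "1 \<le> b" and J: "J \<in> compositions n" for b J
  proof -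
    have "(\<Sum>L\<in>?R. word_functional n v ?w L (hopf_power b (qsym_F J)))
        = (\<Sum>L\<in>?R. \<Sum>K | refines K J. word_functional n v (concat (replicate b ?w)) L (qsym_M K))"
      using b J by (simp add: word_functional_hopf_power compositions_iff)
    also have "\<dots> = (\<Sum>K | refines K J. \<Sum>L\<in>?R. word_functional n v (concat (replicate b ?w)) L (qsym_M K))"
      by (rule sum.swap)
    also have "\<dots> = (\<Sum>K | refines K J. real b ^ length I * (\<Sum>L\<in>?R. split_weight L K))"
      using ref [OF _ J] by (intro sum.cong [OF refl] sum_word_functional v) auto
    finally show ?thesis by (simp add: \<Phi>_def eigen [OF J] sum_distrib_left mult.left_commute)
  qed
  \<comment> \<open>This is the case \<open>b = 1\<close> of \<open>hopf\<close>: the first Hopf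
    power fixes F_K.\<close>
  have "\<Phi> (qsym_F K) = of_rat (eigen_fI I K)" if "K \<in> compositions n" for K
  proof -
    have "K \<in> all_compositions" using that by (simp add: compositions_iff)
    then have "hopf_power 1 (qsym_F K) = (\<Sum>M | refines M K. \<Sum>t\<in>cuts 1 M. prod_list (map qsym_M t))"
      by (simp add: hopf_power_qsym_F sum_refinement_cuts)
    also have "\<dots> = qsym_F K"
    proof -
      have "cuts 1 M = {[M]}" for M by (auto simp: cuts_def length_Suc_conv)
      then show ?thesis by (simp add: qsym_F_def)
    qed
    finally show ?thesis using hopf [of 1 K] that by simp
  qed
  \<comment> \<open>Applying \<open>\<Phi>\<close> to the expansion of the Hopf power in the F turns
    it into the product of the matrix with f_I.\<close>
  then have "(\<Sum>K\<in>compositions n. hopf_power_matrix a n J K * of_rat (eigen_fI I K))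
      = \<Phi> (\<Sum>K\<in>compositions n. hopf_power_matrix a n J K *\<^sub>R qsym_F K)"
    by (simp add: linear)
  \<comment> \<open>Homogeneity is obtained from \<open>linear\<close> with the one-element index
    set \<open>{[]}\<close>.\<close>
  also have "\<dots> = 1 / real a ^ n * \<Phi> (hopf_power a (qsym_F J))"
    unfolding sum_hopf_power_matrix [OF J a]
    using linear [of "\<lambda>_. 1 / real a ^ n" "\<lambda>_. hopf_power a (qsym_F J)" "{[]}"] by simp
  also have "\<dots> = real a powi (int (length I) - int n) * of_rat (eigen_fI I J)"
    using a by (simp add: hopf [OF a J] power_int_diff)
  finally show "(\<Sum>K\<in>compositions n. hopf_power_matrix a n J K * of_rat (eigen_fI I K))
      = real a powi (int (length I) - int n) * of_rat (eigen_fI I J)" .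
qed

theorem theorem6p2p3:
  fixes a n :: nat and I :: "nat list"
  assumes "a \<ge> 1"
    and "I \<in> compositions n" and "sorted_wrt (\<ge>) I"
  shows "(\<forall>J\<in>compositions n.
            eigen_fI I J = 1 / (fact (length I) * of_nat (prod_list I)) *
              (\<Sum>I' | I' \<in> all_compositions \<and> mset I' = mset I.
                 \<Prod>r<length I'. (-1) ^ (length (decomposition I' J ! r) - 1) /
                    of_nat ((sum_list (decomposition I' J ! r) - 1)
                              choose (length (decomposition I' J ! r) - 1))))
       \<and> right_eigenfunction (compositions n) (hopf_power_matrix a n)
            (real a powi (int (length I) - int n)) (\<lambda>J. of_rat (eigen_fI I J))
       \<and> GR_E n I = (\<Sum>\<sigma> | \<sigma> permutes {1..n}. Poly_Mapping.single \<sigma> (eigen_fI I (Des n \<sigma>)))"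
  using eigen_fI_alt [OF assms(2)] right_eigenfunction_eigen_fI [OF assms(1,2)] GR_E_eq [OF assms(2)]
  by blast

end
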